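(* Let $f\colon X\to Y$ be a based map between based spaces satisfying the standing assumptions in the context, let $L_fY$ be the relative free loop space of $f$, and let $(\mathrm{ev},f_* )\colon\Lambda X\to L_fY$ be the canonical map. For $n\geq1$ there is a split extension of groups $$0\to G_{n+1}(Y,X;f)\to G_n\big(L_fY,\Lambda X;(\mathrm{ev},f_* )\big)\to G_n(X)\to 1.$$ For each $n\geq2$, this is a split short exact sequence of abelian groups, and there is an isomorphism of abelian groups $$G_n\big(L_fY,\Lambda X;(\mathrm{ev},f_* )\big)\cong G_n(X)\oplus G_{n+1}(Y,X;f).$$
   Context: Standing assumptions: $X$ and $Y$ are based spaces that are connected, locally compact, Hausdorff and well-pointed (no finiteness or simple connectivity is assumed). Mapping spaces consist of unbased maps and carry the compact-open topology. $\Lambda Y=\mathrm{map}(S^1,Y;0)$ is the path component of the null (constant) maps in the free loop space of $Y$, with the constant loop at the basepoint as basepoint, and $\mathrm{ev}\colon\Lambda Y\to Y$ is evaluation at the basepoint $s_0$ of $S^1$. The relative free loop space $L_fY$ is the pullback of $\mathrm{ev}\colon\Lambda Y\to Y$ along $f$: $L_fY=\{(x,\gamma)\in X\times\Lambda Y : f(x)=\gamma(s_0)\}$ (equivalently, the pullback of the path fibration $P\colon PY\to Y\times Y$, $P(\alpha)=(\alpha(0),\alpha(1))$, along $(f,f)\colon X\to Y\times Y$, restricted to the component of the constant path at the basepoint). The canonical map is $(\mathrm{ev},f_* )(\alpha)=(\alpha(s_0),f\circ\alpha)$. For a based map $g\colon U\to V$, $\mathrm{map}(U,V;g)$ is the path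 component of $g$ in the space of unbased maps $U\to V$, based at $g$, and $\omega\colon\mathrm{map}(U,V;g)\to V$ is evaluation at the basepoint of $U$. The $n$th evaluation subgroup (relative Gottlieb group) $G_n(V,U;g)$ is the image of $\omega_\#\colon\pi_n(\mathrm{map}(U,V;g))\to\pi_n(V)$. The $n$th Gottlieb group is $G_n(V)=G_n(V,V;1_V)$. A split extension is a short exact sequence of groups in which the surjection admits a homomorphic section. *)

theory Defs
  imports "HOL-Analysis.Analysis" "HOL-Algebra.Exact_Sequence"
begin

section \<open>Homotopy groups\<close>

text \<open>Maps are kept extensional throughout, i.e. \<^term>\<open>undefined\<close> off the domain, so that two
  maps are equal as functions exactly when they agree on the domain.\<close>

definition unit_cube :: "nat \<Rightarrow> (nat \<Rightarrow> real) topology" where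
  "unit_cube n = product_topology (\<lambda>_. top_of_set {0..1}) {..<n}"

definition cube_boundary :: "nat \<Rightarrow> (nat \<Rightarrow> real) set" where
  "cube_boundary n = {s \<in> topspace (unit_cube n). \<exists>i<n. s i = 0 \<or> s i = 1}"

definition cube_maps :: "nat \<Rightarrow> 'a topology \<Rightarrow> 'a \<Rightarrow> ((nat \<Rightarrow> real) \<Rightarrow> 'a) set" where
  "cube_maps n X x0 =
     {u \<in> extensional (topspace (unit_cube n)).
        continuous_map (unit_cube n) X u \<and> (\<forall>s\<in>cube_boundary n. u s = x0)}"

definition cube_class ::
    "nat \<Rightarrow> 'a topology \<Rightarrow> 'a \<Rightarrow> ((nat \<Rightarrow> real) \<Rightarrow> 'a) \<Rightarrow> ((nat \<Rightarrow> real) \<Rightarrow> 'a) set" where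
  "cube_class n X x0 u =
     {v \<in> cube_maps n X x0.
        homotopic_with (\<lambda>w. \<forall>s\<in>cube_boundary n. w s = x0) (unit_cube n) X u v}"

definition cube_concat ::
    "nat \<Rightarrow> ((nat \<Rightarrow> real) \<Rightarrow> 'a) \<Rightarrow> ((nat \<Rightarrow> real) \<Rightarrow> 'a) \<Rightarrow> (nat \<Rightarrow> real) \<Rightarrow> 'a" where
  "cube_concat n u v =
     (\<lambda>s\<in>topspace (unit_cube n).
        if s 0 \<le> 1/2 then u (s(0 := 2 * s 0)) else v (s(0 := 2 * s 0 - 1)))"

text \<open>Products of classes, and images of classes under induced maps, are written as unions over all
  representatives; each such union is a single homotopy class.  The definition is meant for
  \<open>n \<ge> 1\<close>.\<close>

definition homotopy_group ::
    "nat \<Rightarrow> 'a topology \<Rightarrow> 'a \<Rightarrow> ((nat \<Rightarrow> real) \<Rightarrow> 'a) set monoid" where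
  "homotopy_group n X x0 =
     \<lparr>carrier = cube_class n X x0 ` cube_maps n X x0,
      mult = (\<lambda>a b. \<Union>u\<in>a. \<Union>v\<in>b. cube_class n X x0 (cube_concat n u v)),
      one = cube_class n X x0 (\<lambda>s\<in>topspace (unit_cube n). x0)\<rparr>"

definition homotopy_group_map ::
    "nat \<Rightarrow> 'b topology \<Rightarrow> 'b \<Rightarrow> ('a \<Rightarrow> 'b) \<Rightarrow>
       ((nat \<Rightarrow> real) \<Rightarrow> 'a) set \<Rightarrow> ((nat \<Rightarrow> real) \<Rightarrow> 'b) set" where
  "homotopy_group_map n Y y0 h a =
     (\<Union>u\<in>a. cube_class n Y y0 (compose (topspace (unit_cube n)) h u))"


section \<open>Mapping spaces and evaluation subgroups\<close>

definition mapping_space :: "'u topology \<Rightarrow> 'v topology \<Rightarrow> ('u \<Rightarrow> 'v) topology" where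
  "mapping_space U V =
     topology_generated_by
       {{h \<in> extensional (topspace U). continuous_map U V h \<and> h ` K \<subseteq> W} | K W.
          compactin U K \<and> openin V W}"

definition map_component :: "'u topology \<Rightarrow> 'v topology \<Rightarrow> ('u \<Rightarrow> 'v) \<Rightarrow> ('u \<Rightarrow> 'v) topology" where
  "map_component U V g =
     subtopology (mapping_space U V)
       (path_component_of_set (mapping_space U V) (restrict g (topspace U)))"

text \<open>The relative group $G_n(V,U;g)$, where \<open>g\<close> is a based map from \<open>(U, u0)\<close> to \<open>(V, v0)\<close>.\<close>

definition rel_Gottlieb_group ::
    "nat \<Rightarrow> 'v topology \<Rightarrow> 'v \<Rightarrow> 'u topology \<Rightarrow> 'u \<Rightarrow> ('u \<Rightarrow> 'v) \<Rightarrow>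
       ((nat \<Rightarrow> real) \<Rightarrow> 'v) set monoid" where
  "rel_Gottlieb_group n V v0 U u0 g =
     (homotopy_group n V v0)
       \<lparr>carrier := homotopy_group_map n V v0 (\<lambda>h. h u0) `
          carrier (homotopy_group n (map_component U V g) (restrict g (topspace U)))\<rparr>"

definition Gottlieb_group ::
    "nat \<Rightarrow> 'v topology \<Rightarrow> 'v \<Rightarrow> ((nat \<Rightarrow> real) \<Rightarrow> 'v) set monoid" where
  "Gottlieb_group n V v0 = rel_Gottlieb_group n V v0 V v0 id"


section \<open>Free loop spaces\<close>

text \<open>The circle is the unit circle in the complex plane, with basepoint \<open>1\<close>.\<close>

definition circle :: "complex topology" where
  "circle = top_of_set (sphere 0 1)"

definition const_loop :: "'a \<Rightarrow> complex \<Rightarrow> 'a" where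
  "const_loop y = (\<lambda>s\<in>topspace circle. y)"

definition null_loop_space :: "'a topology \<Rightarrow> 'a \<Rightarrow> (complex \<Rightarrow> 'a) topology" where
  "null_loop_space Y y0 = map_component circle Y (const_loop y0)"

definition rel_loop_space ::
    "'a topology \<Rightarrow> 'b topology \<Rightarrow> 'b \<Rightarrow> ('a \<Rightarrow> 'b) \<Rightarrow> ('a \<times> (complex \<Rightarrow> 'b)) topology" where
  "rel_loop_space X Y y0 f =
     subtopology (prod_topology X (null_loop_space Y y0)) {(x, \<gamma>). f x = \<gamma> 1}"

definition canonical_loop_map :: "('a \<Rightarrow> 'b) \<Rightarrow> (complex \<Rightarrow> 'a) \<Rightarrow> 'a \<times> (complex \<Rightarrow> 'b)" where
  "canonical_loop_map f \<alpha> = (\<alpha> 1, compose (topspace circle) f \<alpha>)"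


section \<open>Well-pointed spaces\<close>

text \<open>The homotopy extension property of the inclusion of \<open>A\<close> in \<open>X\<close>.  A definition cannot quantify
  over all types of target spaces; the targets carried by \<^typ>\<open>'a \<times> real\<close> suffice, since they include
  the subspace \<open>X \<times> {0} \<union> A \<times> [0,1]\<close> of \<open>X \<times> [0,1]\<close>.  For closed \<open>A\<close>, such as a point of a Hausdorff
  space, lemma \<open>homotopy_extension_all_targets\<close> derives the property for targets of every type.\<close>

definition homotopy_extension :: "'a topology \<Rightarrow> 'a set \<Rightarrow> bool" where
  "homotopy_extension X A \<longleftrightarrow>
     A \<subseteq> topspace X \<and>
     (\<forall>(Z :: ('a \<times> real) topology) h H.
        continuous_map X Z h \<and>
        continuous_map (prod_topology (subtopology X A) (top_of_set {0..1::real})) Z H \<and>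
        (\<forall>a\<in>A. H (a, 0) = h a) \<longrightarrow>
        (\<exists>K. continuous_map (prod_topology X (top_of_set {0..1::real})) Z K \<and>
             (\<forall>x\<in>topspace X. K (x, 0) = h x) \<and>
             (\<forall>a\<in>A. \<forall>t\<in>{0..1}. K (a, t) = H (a, t))))"

definition well_pointed :: "'a topology \<Rightarrow> 'a \<Rightarrow> bool" where
  "well_pointed X x0 \<longleftrightarrow> x0 \<in> topspace X \<and> homotopy_extension X {x0}"

lemma homotopy_extension_all_targets:
  fixes X :: "'a topology" and Z :: "'c topology"
  assumes hep: "homotopy_extension X A" and cl: "closedin X A"
    and h: "continuous_map X Z h"
    and H: "continuous_map (prod_topology (subtopology X A) (top_of_set {0..1})) Z H"
    and hH: "\<And>a. a \<in> A \<Longrightarrow> H (a, 0) = h a"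
  obtains K where "continuous_map (prod_topology X (top_of_set {0..1::real})) Z K"
    "\<And>x. x \<in> topspace X \<Longrightarrow> K (x, 0) = h x"
    "\<And>a t. a \<in> A \<Longrightarrow> t \<in> {0..1} \<Longrightarrow> K (a, t) = H (a, t)"
proof -
  let ?I = "top_of_set {0..1::real}"
  define P where "P = prod_topology X ?I"
  define S where "S = topspace X \<times> {0::real} \<union> A \<times> {0..1}"
  have AX: "A \<subseteq> topspace X"
    using hep by (simp add: homotopy_extension_def)
  have c1: "continuous_map X (subtopology P S) (\<lambda>x. (x, 0))"
    by (auto simp: P_def S_def continuous_map_in_subtopology continuous_map_paired)
  have PA: "prod_topology (subtopology X A) ?I = subtopology P (A \<times> {0..1})"
    by (simp add: P_def prod_topology_subtopology(1))
  have c2: "continuous_map (prod_topology (subtopology X A) ?I) (subtopology P S) id"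
    unfolding PA continuous_map_in_subtopology
    by (auto simp: S_def continuous_map_from_subtopology)
  have "\<exists>K. continuous_map (prod_topology X ?I) (subtopology P S) K \<and>
          (\<forall>x\<in>topspace X. K (x, 0) = (x, 0)) \<and> (\<forall>a\<in>A. \<forall>t\<in>{0..1}. K (a, t) = id (a, t))"
    using hep[unfolded homotopy_extension_def, THEN conjunct2, rule_format,
        of "subtopology P S" "\<lambda>x. (x, 0)" id] c1 c2 by simp
  then obtain r where r: "continuous_map P (subtopology P S) r"
    and r0: "\<And>x. x \<in> topspace X \<Longrightarrow> r (x, 0) = (x, 0)"
    and rA: "\<And>a t. a \<in> A \<Longrightarrow> t \<in> {0..1} \<Longrightarrow> r (a, t) = (a, t)"
    unfolding P_def id_apply by blast
  define g where "g = (\<lambda>z. if snd z = (0::real) then h (fst z) else H z)"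
  define T where "T = (\<lambda>b. if b then topspace X \<times> {0::real} else A \<times> {0..1})"
  have cl0: "closedin ?I {0::real}"
    by (rule closed_subset) auto
  have cl1: "closedin ?I {0..1::real}"
    by (rule closedin_subtopology_refl[THEN iffD2]) simp
  have clT: "closedin P (T b)" for b
    unfolding P_def T_def by (cases b) (simp_all add: closedin_prod_Times_iff cl cl0 cl1)
  have subT: "T b \<subseteq> S" for b
    by (auto simp: T_def S_def)
  have "continuous_map (subtopology P S) Z g"
  proof (rule pasting_lemma_closed[where I = "UNIV" and T = T
          and f = "\<lambda>b. if b then h \<circ> fst else H"])
    show "closedin (subtopology P S) (T b)" for b
      using clT subT by (rule closedin_subset_topspace)
    show "continuous_map (subtopology (subtopology P S) (T b)) Z (if b then h \<circ> fst else H)" for b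
    proof (cases b)
      case True
      have "continuous_map P Z (h \<circ> fst)"
        unfolding P_def using h by (rule continuous_map_compose[OF continuous_map_fst])
      then show ?thesis
        using True by (simp add: continuous_map_from_subtopology)
    next
      case False
      have "S \<inter> (A \<times> {0..1}) = A \<times> {0..1}"
        by (auto simp: S_def)
      then have "subtopology (subtopology P S) (T b) = prod_topology (subtopology X A) ?I"
        using False by (simp add: PA T_def subtopology_subtopology)
      then show ?thesis
        using False H by simp
    qed
    show "(if i then h \<circ> fst else H) x = (if j then h \<circ> fst else H) x"
      if "x \<in> topspace (subtopology P S) \<inter> T i \<inter> T j" for i j x
      using that hH by (auto simp: T_def)
    show "\<exists>j. j \<in> UNIV \<and> x \<in> T j \<and> g x = (if j then h \<circ> fst else H) x"
      if "x \<in> topspace (subtopology P S)" for x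
    proof (cases "snd x = 0")
      case True
      then show ?thesis
        using that AX by (intro exI[of _ True]) (auto simp: T_def S_def g_def)
    next
      case False
      then show ?thesis
        using that by (intro exI[of _ False]) (auto simp: T_def S_def g_def)
    qed
  qed auto
  then have "continuous_map P Z (g \<circ> r)"
    by (rule continuous_map_compose[OF r])
  moreover have "(g \<circ> r) (x, 0) = h x" if "x \<in> topspace X" for x
    using that by (simp add: r0 g_def)
  moreover have "(g \<circ> r) (a, t) = H (a, t)" if "a \<in> A" "t \<in> {0..1}" for a t
    using that hH by (simp add: rA g_def)
  ultimately show thesis
    using that unfolding P_def by blast
qed


section \<open>Split extensions\<close>

definition split_extension ::
    "'a monoid \<Rightarrow> 'b monoid \<Rightarrow> 'c monoid \<Rightarrow> ('a \<Rightarrow> 'b) \<Rightarrow> ('b \<Rightarrow> 'c) \<Rightarrow> bool" where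
  "split_extension A B C i p \<longleftrightarrow>
     group A \<and> group B \<and> group C \<and>
     i \<in> mon A B \<and> p \<in> epi B C \<and> i ` carrier A = kernel B C p \<and>
     (\<exists>s \<in> hom C B. \<forall>c \<in> carrier C. p (s c) = c)"

end

theory Submission
  imports Defs
begin

text \<open>
  Sending \<open>(x, \<gamma>)\<close> to \<open>x\<close> makes \<open>L\<^sub>fY\<close> a fibration over \<open>X\<close> whose fibre over the basepoint is the
  based loop space of \<open>Y\<close>, and \<open>x \<mapsto> (x, constant loop at f x)\<close> is a section of it.  Hence the long
  exact homotopy sequence falls apart into split extensions of \<open>\<pi>\<^sub>n(X)\<close> by \<open>\<pi>\<^sub>n\<^sub>+\<^sub>1(Y)\<close> with middle term
  \<open>\<pi>\<^sub>n(L\<^sub>fY)\<close>.  The theorem holds because this extension restricts to the evaluation subgroups.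

  Membership in \<open>G\<^sub>n(V, U; g)\<close> is an extension property: by currying, a class belongs to it as soon as
  it is represented by \<open>s \<mapsto> F s u\<^sub>0\<close> for a continuous \<open>F\<close> on \<open>I\<^sup>n \<times> U\<close> that is \<open>g\<close> on \<open>\<partial>I\<^sup>n \<times> U\<close>
  (\<open>rel_Gottlieb_classI\<close>).  The converse needs \<open>U\<close> to be locally compact, and the loop space of \<open>X\<close>
  need not be.  It suffices, however, to know \<open>F\<close> on constant loops, and these form a copy of the
  locally compact space \<open>X\<close>: \<open>rel_Gottlieb_classE\<close> therefore pulls the adjoint map back along a map
  into \<open>U\<close> before uncurrying it.

  With \<open>F\<close> at hand, two of the three maps of the extension are seen to preserve evaluation subgroups
  by writing down a new \<open>F\<close>: for the inclusion of the fibre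
  \<open>(s, \<alpha>) \<mapsto> (\<alpha> 1, e\<^sup>2\<^sup>\<pi>\<^sup>i\<^sup>t \<mapsto> F (s, t) (\<alpha> e\<^sup>2\<^sup>\<pi>\<^sup>i\<^sup>t))\<close> (\<open>loop_class_map_G_map\<close>), and for the section
  \<open>(s, \<alpha>) \<mapsto> (F s (\<alpha> 1), f \<circ> F s \<circ> \<alpha>)\<close> (\<open>sect_G_space\<close>); for the projection one restricts to constant
  loops (\<open>proj_G_loop\<close>).

  The substance is exactness in the middle (\<open>kernel_proj_G_loop\<close>).  If \<open>b\<close> is a class in the
  evaluation subgroup of \<open>L\<^sub>fY\<close> with trivial projection \<open>p b\<close>, then \<open>b = b (\<sigma> (p b))\<^sup>-\<^sup>1\<close> for the
  section \<open>\<sigma>\<close>.  For the obvious representative of the right-hand side the component in \<open>X\<close> runs forth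
  and back along the same path, so it contracts by a formula that makes sense over all of \<open>X\<close> at once
  and fixes what happens on \<open>\<partial>I\<^sup>n\<close>.  Dragging the loops along this contraction gives a map
  \<open>I\<^sup>n\<^sup>+\<^sup>1 \<times> X \<rightarrow> Y\<close> which exhibits \<open>b\<close> as the image of an element of \<open>G\<^sub>n\<^sub>+\<^sub>1(Y, X; f)\<close>.  That the
  inclusion of the fibre is injective on homotopy groups is \<open>loop_adjoint_null\<close>.

  For \<open>n \<ge> 2\<close> all groups are commutative by the Eckmann-Hilton argument (\<open>concat_commute\<close>), and a split
  extension with commutative middle term is a direct product (\<open>split_extension_comm_iso\<close>).
\<close>

section \<open>Continuous maps into intervals and cubes\<close>

abbreviation I01 :: "real topology" where
  "I01 \<equiv> top_of_set {0..1}"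

text \<open>Formulas for homotopies are clamped to the unit interval, so that they are continuous on the
  whole cube and only their values need a distinction of cases.\<close>

definition clip :: "real \<Rightarrow> real" where
  "clip t = max 0 (min 1 t)"

lemma clip_bounds [simp]: "0 \<le> clip t" "clip t \<le> 1"
  by (auto simp: clip_def)

lemma clip_le_0 [simp]: "t \<le> 0 \<Longrightarrow> clip t = 0"
  and clip_ge_1 [simp]: "1 \<le> t \<Longrightarrow> clip t = 1"
  and clip_id [simp]: "0 \<le> t \<Longrightarrow> t \<le> 1 \<Longrightarrow> clip t = t"
  by (auto simp: clip_def)

lemma continuous_map_comp2:
  "continuous_map P Z F \<Longrightarrow> continuous_map T P g \<Longrightarrow> continuous_map T Z (\<lambda>x. F (g x))"
  using continuous_map_compose[of T P g Z F] by (simp add: o_def)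

lemma continuous_map_into_I01:
  "continuous_map T I01 g \<longleftrightarrow>
     continuous_map T euclideanreal g \<and> (\<forall>x\<in>topspace T. 0 \<le> g x \<and> g x \<le> 1)"
  by (auto simp: continuous_map_in_subtopology image_subset_iff)

lemma continuous_map_clip [continuous_intros]:
  "continuous_map T euclideanreal g \<Longrightarrow> continuous_map T euclideanreal (\<lambda>x. clip (g x))"
  unfolding clip_def by (intro continuous_intros) auto

lemma continuous_map_clip_I01:
  "continuous_map T euclideanreal g \<Longrightarrow> continuous_map T I01 (\<lambda>x. clip (g x))"
  by (simp add: continuous_map_into_I01 continuous_map_clip)

lemma continuous_map_real_const: "continuous_map T euclideanreal (\<lambda>x. c)"
  by simp

lemmas real_continuous = continuous_map_clip continuous_map_real_const continuous_map_add
  continuous_map_diff continuous_map_real_min continuous_map_real_max continuous_map_real_mult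

lemma topspace_unit_cube:
  "s \<in> topspace (unit_cube n) \<longleftrightarrow> s \<in> extensional {..<n} \<and> (\<forall>i<n. 0 \<le> s i \<and> s i \<le> 1)"
  by (auto simp: unit_cube_def PiE_iff)

lemma cube_upd_in_topspace:
  "s \<in> topspace (unit_cube n) \<Longrightarrow> j < n \<Longrightarrow> 0 \<le> t \<Longrightarrow> t \<le> 1 \<Longrightarrow>
     s(j := t) \<in> topspace (unit_cube n)"
  by (auto simp: topspace_unit_cube extensional_def)

lemma cube_coord_bounds:
  "s \<in> topspace (unit_cube n) \<Longrightarrow> j < n \<Longrightarrow> 0 \<le> s j \<and> s j \<le> 1"
  by (auto simp: topspace_unit_cube)

lemma cube_boundary_iff:
  "s \<in> cube_boundary n \<longleftrightarrow> s \<in> topspace (unit_cube n) \<and> (\<exists>i<n. s i = 0 \<or> s i = 1)"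
  by (auto simp: cube_boundary_def)

lemma cube_boundary_upd:
  "s \<in> topspace (unit_cube n) \<Longrightarrow> j < n \<Longrightarrow> t = 0 \<or> t = 1 \<Longrightarrow> s(j := t) \<in> cube_boundary n"
  by (auto simp: cube_boundary_iff topspace_unit_cube extensional_def)

lemma cube_boundary_upd_other:
  assumes "s \<in> cube_boundary n" "j < n" "0 \<le> t" "t \<le> 1" "s j = 0 \<or> s j = 1 \<Longrightarrow> t = 0 \<or> t = 1"
  shows "s(j := t) \<in> cube_boundary n"
proof -
  obtain i where i: "i < n" "s i = 0 \<or> s i = 1"
    using assms(1) by (auto simp: cube_boundary_iff)
  have "s(j := t) \<in> topspace (unit_cube n)"
    using assms by (intro cube_upd_in_topspace) (auto simp: cube_boundary_iff)
  moreover have "(s(j := t)) i = 0 \<or> (s(j := t)) i = 1"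
    using i assms(5) by auto
  ultimately show ?thesis
    using i by (auto simp: cube_boundary_iff)
qed

lemma continuous_map_cube_coord:
  "continuous_map T (unit_cube n) g \<Longrightarrow> i < n \<Longrightarrow> continuous_map T euclideanreal (\<lambda>x. g x i)"
  unfolding unit_cube_def continuous_map_componentwise
  by (auto simp: continuous_map_in_subtopology)

lemma continuous_map_cube_upd:
  assumes "continuous_map T (unit_cube n) g" "continuous_map T I01 h" "j < n"
  shows "continuous_map T (unit_cube n) (\<lambda>x. (g x)(j := h x))"
  unfolding unit_cube_def continuous_map_componentwise
proof (intro conjI ballI)
  show "(\<lambda>x. (g x)(j := h x)) ` topspace T \<subseteq> extensional {..<n}"
    using assms by (auto simp: unit_cube_def continuous_map_componentwise extensional_def)
  show "continuous_map T I01 (\<lambda>x. ((g x)(j := h x)) k)" if "k \<in> {..<n}" for k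
    using assms that by (cases "k = j") (auto simp: unit_cube_def continuous_map_componentwise)
qed

lemma continuous_map_cube_upd_clip:
  assumes "continuous_map T (unit_cube n) g" "continuous_map T euclideanreal c" "j < n"
  shows "continuous_map T (unit_cube n) (\<lambda>x. (g x)(j := clip (c x)))"
  using assms by (intro continuous_map_cube_upd continuous_map_clip_I01)

section \<open>Homotopy of cube maps\<close>

definition cube_homotopic ::
    "nat \<Rightarrow> 'a topology \<Rightarrow> 'a \<Rightarrow> ((nat \<Rightarrow> real) \<Rightarrow> 'a) \<Rightarrow> ((nat \<Rightarrow> real) \<Rightarrow> 'a) \<Rightarrow> bool" where
  "cube_homotopic n Z z0 u v \<longleftrightarrow>
     u \<in> cube_maps n Z z0 \<and> v \<in> cube_maps n Z z0 \<and>
     homotopic_with (\<lambda>w. \<forall>s\<in>cube_boundary n. w s = z0) (unit_cube n) Z u v"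

lemma cube_homotopic_with_iff:
  "homotopic_with (\<lambda>w. \<forall>s\<in>cube_boundary n. w s = z0) (unit_cube n) Z u v \<longleftrightarrow>
     (\<exists>h. continuous_map (prod_topology I01 (unit_cube n)) Z h \<and>
          (\<forall>s\<in>topspace (unit_cube n). h (0, s) = u s) \<and>
          (\<forall>s\<in>topspace (unit_cube n). h (1, s) = v s) \<and>
          (\<forall>t\<in>{0..1}. \<forall>s\<in>cube_boundary n. h (t, s) = z0))"
  by (rule homotopic_with) (auto simp: cube_boundary_def)

lemma cube_homotopicI:
  assumes H: "continuous_map (prod_topology I01 (unit_cube n)) Z (\<lambda>x. H (fst x) (snd x))"
    and bd: "\<And>t s. 0 \<le> t \<Longrightarrow> t \<le> 1 \<Longrightarrow> s \<in> cube_boundary n \<Longrightarrow> H t s = z0"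
    and u: "u \<in> extensional (topspace (unit_cube n))"
      "\<And>s. s \<in> topspace (unit_cube n) \<Longrightarrow> H 0 s = u s"
    and v: "v \<in> extensional (topspace (unit_cube n))"
      "\<And>s. s \<in> topspace (unit_cube n) \<Longrightarrow> H 1 s = v s"
  shows "cube_homotopic n Z z0 u v"
proof -
  let ?P = "\<lambda>w. \<forall>s\<in>cube_boundary n. w s = z0"
  have hw: "homotopic_with ?P (unit_cube n) Z u v"
    unfolding cube_homotopic_with_iff
    by (rule exI[of _ "\<lambda>x. H (fst x) (snd x)"]) (use assms in auto)
  then show ?thesis
    using u(1) v(1) homotopic_with_imp_continuous_maps[OF hw] homotopic_with_imp_property[OF hw]
    by (auto simp: cube_homotopic_def cube_maps_def)
qed

lemma cube_homotopicE:
  assumes "cube_homotopic n Z z0 u v"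
  obtains H where "continuous_map (prod_topology I01 (unit_cube n)) Z (\<lambda>x. H (fst x) (snd x))"
    "\<And>t s. 0 \<le> t \<Longrightarrow> t \<le> 1 \<Longrightarrow> s \<in> cube_boundary n \<Longrightarrow> H t s = z0"
    "\<And>s. s \<in> topspace (unit_cube n) \<Longrightarrow> H 0 s = u s"
    "\<And>s. s \<in> topspace (unit_cube n) \<Longrightarrow> H 1 s = v s"
proof -
  obtain h where "continuous_map (prod_topology I01 (unit_cube n)) Z h"
    "\<forall>s\<in>topspace (unit_cube n). h (0, s) = u s"
    "\<forall>s\<in>topspace (unit_cube n). h (1, s) = v s"
    "\<forall>t\<in>{0..1}. \<forall>s\<in>cube_boundary n. h (t, s) = z0"
    using assms unfolding cube_homotopic_def cube_homotopic_with_iff by blast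
  then show thesis
    by (intro that[of "\<lambda>t s. h (t, s)"]) auto
qed

lemma cube_homotopic_in_maps:
  assumes "cube_homotopic n Z z0 u v"
  shows "u \<in> cube_maps n Z z0" "v \<in> cube_maps n Z z0"
  using assms by (auto simp: cube_homotopic_def)

lemma cube_homotopic_refl: "u \<in> cube_maps n Z z0 \<Longrightarrow> cube_homotopic n Z z0 u u"
  by (auto simp: cube_homotopic_def cube_maps_def)

lemma cube_homotopic_sym: "cube_homotopic n Z z0 u v \<Longrightarrow> cube_homotopic n Z z0 v u"
  by (auto simp: cube_homotopic_def dest: homotopic_with_symD)

lemma cube_homotopic_trans [trans]:
  "cube_homotopic n Z z0 u v \<Longrightarrow> cube_homotopic n Z z0 v w \<Longrightarrow> cube_homotopic n Z z0 u w"
  by (auto simp: cube_homotopic_def intro: homotopic_with_trans)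

lemma mem_cube_class:
  "u \<in> cube_maps n Z z0 \<Longrightarrow> v \<in> cube_class n Z z0 u \<longleftrightarrow> cube_homotopic n Z z0 u v"
  by (auto simp: cube_class_def cube_homotopic_def)

lemma cube_class_eq_iff:
  assumes "u \<in> cube_maps n Z z0" "v \<in> cube_maps n Z z0"
  shows "cube_class n Z z0 u = cube_class n Z z0 v \<longleftrightarrow> cube_homotopic n Z z0 u v"
  using assms mem_cube_class cube_homotopic_refl cube_homotopic_sym cube_homotopic_trans
  by (metis subsetI subset_antisym)

lemma cube_class_eqI:
  "cube_homotopic n Z z0 u v \<Longrightarrow> cube_class n Z z0 u = cube_class n Z z0 v"
  using cube_class_eq_iff cube_homotopic_in_maps by metis

text \<open>A class-valued operation that respects homotopy may be evaluated on any representative.\<close>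

lemma Union_cube_class:
  assumes "u \<in> cube_maps n Z z0"
    and "\<And>v. cube_homotopic n Z z0 u v \<Longrightarrow> F v = F u"
  shows "(\<Union>v\<in>cube_class n Z z0 u. F v) = F u"
  using assms mem_cube_class[OF assms(1)] cube_homotopic_refl[OF assms(1)] by blast

lemma cube_maps_const:
  "z0 \<in> topspace Z \<Longrightarrow> (\<lambda>s\<in>topspace (unit_cube n). z0) \<in> cube_maps n Z z0"
  by (auto simp: cube_maps_def cube_boundary_iff continuous_map_eq[of _ _ "\<lambda>s. z0"])

lemma cube_maps_continuous: "u \<in> cube_maps n Z z0 \<Longrightarrow> continuous_map (unit_cube n) Z u"
  and cube_maps_boundary: "u \<in> cube_maps n Z z0 \<Longrightarrow> s \<in> cube_boundary n \<Longrightarrow> u s = z0"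
  and cube_maps_extensional: "u \<in> cube_maps n Z z0 \<Longrightarrow> u \<in> extensional (topspace (unit_cube n))"
  by (auto simp: cube_maps_def)

lemma cube_mapsI:
  assumes "continuous_map (unit_cube n) Z u" "\<And>s. s \<in> cube_boundary n \<Longrightarrow> u s = z0"
  shows "restrict u (topspace (unit_cube n)) \<in> cube_maps n Z z0"
  using assms by (auto simp: cube_maps_def cube_boundary_iff continuous_map_eq[of _ _ u])

lemma cube_homotopic_compose:
  assumes "cube_homotopic n Z z0 u v" "continuous_map Z W h" "h z0 = w0"
  shows "cube_homotopic n W w0
           (compose (topspace (unit_cube n)) h u) (compose (topspace (unit_cube n)) h v)"
proof -
  obtain H where H: "continuous_map (prod_topology I01 (unit_cube n)) Z (\<lambda>x. H (fst x) (snd x))"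
    "\<And>t s. 0 \<le> t \<Longrightarrow> t \<le> 1 \<Longrightarrow> s \<in> cube_boundary n \<Longrightarrow> H t s = z0"
    "\<And>s. s \<in> topspace (unit_cube n) \<Longrightarrow> H 0 s = u s"
    "\<And>s. s \<in> topspace (unit_cube n) \<Longrightarrow> H 1 s = v s"
    by (rule cube_homotopicE[OF assms(1)]) blast
  show ?thesis
    by (rule cube_homotopicI[where H = "\<lambda>t s. h (H t s)"])
       (use H assms in \<open>auto simp: compose_def intro: continuous_map_comp2[OF assms(2)]\<close>)
qed

text \<open>The straight-line homotopy between two reparametrizations of one coordinate.  Endpoints may be
  sent to either end of the interval, which covers the null homotopy of a path followed by its
  reverse as well as associativity and the unit laws.\<close>

lemma cube_homotopic_reparametrize:
  assumes u: "u \<in> cube_maps n Z z0" and j: "j < n"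
    and \<phi>: "continuous_map I01 I01 \<phi>" and \<psi>: "continuous_map I01 I01 \<psi>"
    and e0: "\<phi> 0 = 0 \<or> \<phi> 0 = 1" "\<psi> 0 = \<phi> 0" and e1: "\<phi> 1 = 0 \<or> \<phi> 1 = 1" "\<psi> 1 = \<phi> 1"
  shows "cube_homotopic n Z z0
           (\<lambda>s\<in>topspace (unit_cube n). u (s(j := \<phi> (s j))))
           (\<lambda>s\<in>topspace (unit_cube n). u (s(j := \<psi> (s j))))"
proof (rule cube_homotopicI[where H = "\<lambda>t s. u (s(j := (1 - t) * \<phi> (s j) + t * \<psi> (s j)))"])
  let ?T = "prod_topology I01 (unit_cube n)"
  have b: "0 \<le> \<phi> r \<and> \<phi> r \<le> 1" "0 \<le> \<psi> r \<and> \<psi> r \<le> 1" if "0 \<le> r" "r \<le> 1" for r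
    using that \<phi> \<psi> by (auto simp: continuous_map_into_I01)
  have c: "0 \<le> (1 - t) * a + t * b \<and> (1 - t) * a + t * b \<le> 1"
    if "0 \<le> t" "t \<le> 1" "0 \<le> a \<and> a \<le> 1" "0 \<le> b \<and> b \<le> 1" for t a b :: real
    using that convex_bound_le[of a 1 b "1 - t" t] by auto
  have cj: "continuous_map ?T I01 (\<lambda>x. snd x j)"
    using j by (auto simp: continuous_map_into_I01 topspace_unit_cube
        intro: continuous_map_cube_coord continuous_map_snd)
  have "continuous_map ?T I01 (\<lambda>x. (1 - fst x) * \<phi> (snd x j) + fst x * \<psi> (snd x j))"
    unfolding continuous_map_into_I01
  proof
    have f: "continuous_map ?T euclideanreal fst"
      using continuous_map_fst[of I01 "unit_cube n"] by (simp add: continuous_map_into_I01)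
    show "continuous_map ?T euclideanreal (\<lambda>x. (1 - fst x) * \<phi> (snd x j) + fst x * \<psi> (snd x j))"
      using continuous_map_comp2[OF \<phi> cj] continuous_map_comp2[OF \<psi> cj] f
      by (intro real_continuous) (auto simp: continuous_map_into_I01)
    show "\<forall>x\<in>topspace ?T. 0 \<le> (1 - fst x) * \<phi> (snd x j) + fst x * \<psi> (snd x j) \<and>
        (1 - fst x) * \<phi> (snd x j) + fst x * \<psi> (snd x j) \<le> 1"
    proof
      fix x assume x: "x \<in> topspace ?T"
      show "0 \<le> (1 - fst x) * \<phi> (snd x j) + fst x * \<psi> (snd x j) \<and>
          (1 - fst x) * \<phi> (snd x j) + fst x * \<psi> (snd x j) \<le> 1"
        by (rule c) (use x b[of "snd x j"] cube_coord_bounds[OF _ j, of "snd x"] in auto)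
    qed
  qed
  then show "continuous_map ?T Z
      (\<lambda>x. u ((snd x)(j := (1 - fst x) * \<phi> (snd x j) + fst x * \<psi> (snd x j))))"
    by (intro continuous_map_comp2[OF cube_maps_continuous[OF u]] continuous_map_cube_upd
        continuous_map_snd j)
  show "u (s(j := (1 - t) * \<phi> (s j) + t * \<psi> (s j))) = z0"
    if "0 \<le> t" "t \<le> 1" "s \<in> cube_boundary n" for t s
  proof (rule cube_maps_boundary[OF u], rule cube_boundary_upd_other[OF that(3) j])
    have "0 \<le> s j" "s j \<le> 1"
      using that(3) j by (auto simp: cube_boundary_iff topspace_unit_cube)
    then show "0 \<le> (1 - t) * \<phi> (s j) + t * \<psi> (s j)" "(1 - t) * \<phi> (s j) + t * \<psi> (s j) \<le> 1"
      using c[OF that(1,2) b] by auto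
    show "(1 - t) * \<phi> (s j) + t * \<psi> (s j) = 0 \<or> (1 - t) * \<phi> (s j) + t * \<psi> (s j) = 1"
      if "s j = 0 \<or> s j = 1"
      using that e0 e1 by (auto simp: algebra_simps)
  qed
qed auto

section \<open>Concatenation in an arbitrary coordinate\<close>

text \<open>The product of homotopy classes uses coordinate 0; concatenation in a second coordinate is what
  makes the higher groups commutative.\<close>

definition concat_along ::
    "nat \<Rightarrow> nat \<Rightarrow> ((nat \<Rightarrow> real) \<Rightarrow> 'a) \<Rightarrow> ((nat \<Rightarrow> real) \<Rightarrow> 'a) \<Rightarrow> (nat \<Rightarrow> real) \<Rightarrow> 'a" where
  "concat_along j n u v =
     (\<lambda>s\<in>topspace (unit_cube n).
        if s j \<le> 1/2 then u (s(j := 2 * s j)) else v (s(j := 2 * s j - 1)))"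

lemma cube_concat_eq: "cube_concat n = concat_along 0 n"
  by (simp add: cube_concat_def concat_along_def fun_eq_iff)

text \<open>The parameter space \<open>T\<close> makes the lemma apply to homotopies of cube maps.\<close>

lemma continuous_map_concat:
  assumes j: "j < n"
    and U: "continuous_map (prod_topology T (unit_cube n)) Z (\<lambda>x. U (fst x) (snd x))"
    and V: "continuous_map (prod_topology T (unit_cube n)) Z (\<lambda>x. V (fst x) (snd x))"
    and bd: "\<And>t s. t \<in> topspace T \<Longrightarrow> s \<in> topspace (unit_cube n) \<Longrightarrow> U t (s(j := 1)) = V t (s(j := 0))"
  shows "continuous_map (prod_topology T (unit_cube n)) Z
           (\<lambda>x. concat_along j n (U (fst x)) (V (fst x)) (snd x))"
proof -
  let ?T = "prod_topology T (unit_cube n)"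
  have cj: "continuous_map ?T euclideanreal (\<lambda>x. snd x j)"
    by (rule continuous_map_cube_coord[OF continuous_map_snd j])
  have "continuous_map ?T Z (\<lambda>x. if snd x j \<le> 1/2
           then U (fst x) ((snd x)(j := clip (2 * snd x j)))
           else V (fst x) ((snd x)(j := clip (2 * snd x j - 1))))"
  proof (rule continuous_map_cases_le)
    have *: "continuous_map ?T (prod_topology T (unit_cube n)) (\<lambda>x. (fst x, (snd x)(j := clip (c x))))"
      if "continuous_map ?T euclideanreal c" for c
      by (intro continuous_map_pairedI continuous_map_fst continuous_map_cube_upd_clip
          continuous_map_snd j that)
    have "continuous_map ?T Z (\<lambda>x. U (fst x) ((snd x)(j := clip (2 * snd x j))))"
      "continuous_map ?T Z (\<lambda>x. V (fst x) ((snd x)(j := clip (2 * snd x j - 1))))"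
      using continuous_map_comp2[OF U *] continuous_map_comp2[OF V *]
      by (simp_all add: real_continuous cj)
    then show "continuous_map (subtopology ?T {x \<in> topspace ?T. snd x j \<le> 1/2}) Z
          (\<lambda>x. U (fst x) ((snd x)(j := clip (2 * snd x j))))"
        "continuous_map (subtopology ?T {x \<in> topspace ?T. 1/2 \<le> snd x j}) Z
          (\<lambda>x. V (fst x) ((snd x)(j := clip (2 * snd x j - 1))))"
      by (auto intro: continuous_map_from_subtopology)
  qed (use cj bd in auto)
  then show ?thesis
    by (rule continuous_map_eq) (use j in \<open>auto simp: concat_along_def topspace_unit_cube\<close>)
qed

lemma cube_homotopic_concat:
  assumes j: "j < n" and u: "cube_homotopic n Z z0 u u'" and v: "cube_homotopic n Z z0 v v'"
  shows "cube_homotopic n Z z0 (concat_along j n u v) (concat_along j n u' v')"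
proof -
  obtain U where U: "continuous_map (prod_topology I01 (unit_cube n)) Z (\<lambda>x. U (fst x) (snd x))"
    "\<And>t s. 0 \<le> t \<Longrightarrow> t \<le> 1 \<Longrightarrow> s \<in> cube_boundary n \<Longrightarrow> U t s = z0"
    "\<And>s. s \<in> topspace (unit_cube n) \<Longrightarrow> U 0 s = u s"
    "\<And>s. s \<in> topspace (unit_cube n) \<Longrightarrow> U 1 s = u' s"
    by (rule cube_homotopicE[OF u]) blast
  obtain V where V: "continuous_map (prod_topology I01 (unit_cube n)) Z (\<lambda>x. V (fst x) (snd x))"
    "\<And>t s. 0 \<le> t \<Longrightarrow> t \<le> 1 \<Longrightarrow> s \<in> cube_boundary n \<Longrightarrow> V t s = z0"
    "\<And>s. s \<in> topspace (unit_cube n) \<Longrightarrow> V 0 s = v s"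
    "\<And>s. s \<in> topspace (unit_cube n) \<Longrightarrow> V 1 s = v' s"
    by (rule cube_homotopicE[OF v]) blast
  show ?thesis
  proof (rule cube_homotopicI[where H = "\<lambda>t. concat_along j n (U t) (V t)"])
    show "continuous_map (prod_topology I01 (unit_cube n)) Z
        (\<lambda>x. concat_along j n (U (fst x)) (V (fst x)) (snd x))"
    proof (rule continuous_map_concat[OF j U(1) V(1)])
      show "U t (s(j := 1)) = V t (s(j := 0))"
        if "t \<in> topspace I01" "s \<in> topspace (unit_cube n)" for t s
        using that U(2)[of t "s(j := 1)"] V(2)[of t "s(j := 0)"] cube_boundary_upd[OF that(2) j]
        by simp
    qed
    show "concat_along j n (U t) (V t) s = z0"
      if t: "0 \<le> t" "t \<le> 1" and s: "s \<in> cube_boundary n" for t s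
    proof -
      have s': "s \<in> topspace (unit_cube n)" "0 \<le> s j" "s j \<le> 1"
        using s j by (auto simp: cube_boundary_iff topspace_unit_cube)
      have "s(j := 2 * s j) \<in> cube_boundary n" if "s j \<le> 1/2"
        using s s' that by (intro cube_boundary_upd_other j) auto
      moreover have "s(j := 2 * s j - 1) \<in> cube_boundary n" if "\<not> s j \<le> 1/2"
        using s s' that by (intro cube_boundary_upd_other j) auto
      ultimately show ?thesis
        using U(2) V(2) t s' by (auto simp: concat_along_def)
    qed
  qed (use U V j in \<open>auto simp: concat_along_def cube_upd_in_topspace topspace_unit_cube extensional_def\<close>)
qed

lemma concat_along_in_maps:
  "j < n \<Longrightarrow> u \<in> cube_maps n Z z0 \<Longrightarrow> v \<in> cube_maps n Z z0 \<Longrightarrow>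
     concat_along j n u v \<in> cube_maps n Z z0"
  using cube_homotopic_concat cube_homotopic_in_maps cube_homotopic_refl by metis

lemma cube_homotopic_reparametrize_id:
  assumes u: "u \<in> cube_maps n Z z0" and j: "j < n" and \<phi>: "continuous_map I01 I01 \<phi>"
    and "\<phi> 0 = 0" "\<phi> 1 = 1"
  shows "cube_homotopic n Z z0 (\<lambda>s\<in>topspace (unit_cube n). u (s(j := \<phi> (s j)))) u"
proof -
  have "(\<lambda>s\<in>topspace (unit_cube n). u (s(j := id (s j)))) = u"
    using cube_maps_extensional[OF u] by (auto simp: fun_eq_iff extensional_def)
  then show ?thesis
    using cube_homotopic_reparametrize[OF u j \<phi>, of id] assms by auto
qed

text \<open>The two bracketings differ by the piecewise linear reparametrization with slopes 2, 1 and 1/2,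
  which is concave and hence a minimum of three affine functions.\<close>

lemma concat_assoc:
  assumes j: "j < n" and u: "u \<in> cube_maps n Z z0" and v: "v \<in> cube_maps n Z z0"
    and w: "w \<in> cube_maps n Z z0"
  shows "cube_homotopic n Z z0 (concat_along j n (concat_along j n u v) w)
           (concat_along j n u (concat_along j n v w))"
proof -
  define \<phi> where "\<phi> = (\<lambda>r::real. min (2 * r) (min (r + 1/4) (1/2 * r + 1/2)))"
  have "continuous_map I01 I01 \<phi>"
    unfolding \<phi>_def continuous_map_into_I01
    by (intro conjI real_continuous) (auto intro: continuous_map_from_subtopology)
  then have "cube_homotopic n Z z0
      (\<lambda>s\<in>topspace (unit_cube n). concat_along j n u (concat_along j n v w) (s(j := \<phi> (s j))))
      (concat_along j n u (concat_along j n v w))"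
    by (intro cube_homotopic_reparametrize_id concat_along_in_maps u v w j) (auto simp: \<phi>_def)
  moreover have "concat_along j n (concat_along j n u v) w s =
      (if s \<in> topspace (unit_cube n)
       then concat_along j n u (concat_along j n v w) (s(j := \<phi> (s j))) else undefined)" for s
  proof (cases "s \<in> topspace (unit_cube n)")
    case True
    then have s: "0 \<le> s j" "s j \<le> 1"
      using j by (auto simp: topspace_unit_cube)
    have upd: "s(j := r) \<in> topspace (unit_cube n) \<longleftrightarrow> 0 \<le> r \<and> r \<le> 1" for r
      using True j by (auto simp: topspace_unit_cube extensional_def)
    consider "s j \<le> 1/4" | "1/4 < s j" "s j \<le> 1/2" | "1/2 < s j"
      by linarith
    then show ?thesis
    proof cases
      case 1
      then have "\<phi> (s j) = 2 * s j" by (auto simp: \<phi>_def)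
      then show ?thesis using 1 s True upd by (simp add: concat_along_def)
    next
      case 2
      then have "\<phi> (s j) = s j + 1/4" by (auto simp: \<phi>_def)
      then show ?thesis using 2 s True upd by (simp add: concat_along_def algebra_simps)
    next
      case 3
      then have "\<phi> (s j) = 1/2 * s j + 1/2" by (auto simp: \<phi>_def)
      then show ?thesis using 3 s True upd by (simp add: concat_along_def algebra_simps)
    qed
  qed (simp add: concat_along_def)
  then have "concat_along j n (concat_along j n u v) w =
      (\<lambda>s\<in>topspace (unit_cube n). concat_along j n u (concat_along j n v w) (s(j := \<phi> (s j))))"
    by (simp add: fun_eq_iff)
  ultimately show ?thesis
    by simp
qed

lemma concat_const_right:
  assumes j: "j < n" and u: "u \<in> cube_maps n Z z0"
  shows "cube_homotopic n Z z0 (concat_along j n u (\<lambda>s\<in>topspace (unit_cube n). z0)) u"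
proof -
  define \<phi> where "\<phi> = (\<lambda>r::real. min (2 * r) 1)"
  have "continuous_map I01 I01 \<phi>"
    unfolding \<phi>_def continuous_map_into_I01
    by (intro conjI real_continuous) (auto intro: continuous_map_from_subtopology)
  then have "cube_homotopic n Z z0 (\<lambda>s\<in>topspace (unit_cube n). u (s(j := \<phi> (s j)))) u"
    by (intro cube_homotopic_reparametrize_id u j) (auto simp: \<phi>_def)
  moreover have "(\<lambda>s\<in>topspace (unit_cube n). u (s(j := \<phi> (s j)))) =
      concat_along j n u (\<lambda>s\<in>topspace (unit_cube n). z0)"
    using cube_coord_bounds[OF _ j] cube_boundary_upd[OF _ j] cube_upd_in_topspace[OF _ j]
    by (auto simp: fun_eq_iff concat_along_def \<phi>_def min_def cube_maps_boundary[OF u])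
  ultimately show ?thesis by simp
qed

lemma concat_const_left:
  assumes j: "j < n" and u: "u \<in> cube_maps n Z z0"
  shows "cube_homotopic n Z z0 (concat_along j n (\<lambda>s\<in>topspace (unit_cube n). z0) u) u"
proof -
  define \<phi> where "\<phi> = (\<lambda>r::real. max (2 * r - 1) 0)"
  have "continuous_map I01 I01 \<phi>"
    unfolding \<phi>_def continuous_map_into_I01
    by (intro conjI real_continuous) (auto intro: continuous_map_from_subtopology)
  then have "cube_homotopic n Z z0 (\<lambda>s\<in>topspace (unit_cube n). u (s(j := \<phi> (s j)))) u"
    by (intro cube_homotopic_reparametrize_id u j) (auto simp: \<phi>_def)
  moreover have "(\<lambda>s\<in>topspace (unit_cube n). u (s(j := \<phi> (s j)))) =
      concat_along j n (\<lambda>s\<in>topspace (unit_cube n). z0) u"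
    using cube_coord_bounds[OF _ j] cube_boundary_upd[OF _ j] cube_upd_in_topspace[OF _ j]
    by (auto simp: fun_eq_iff concat_along_def \<phi>_def max_def cube_maps_boundary[OF u])
  ultimately show ?thesis by simp
qed

definition cube_reverse :: "nat \<Rightarrow> ((nat \<Rightarrow> real) \<Rightarrow> 'a) \<Rightarrow> (nat \<Rightarrow> real) \<Rightarrow> 'a" where
  "cube_reverse n u = (\<lambda>s\<in>topspace (unit_cube n). u (s(0 := 1 - s 0)))"

lemma cube_reverse_in_maps:
  assumes "0 < n" "u \<in> cube_maps n Z z0"
  shows "cube_reverse n u \<in> cube_maps n Z z0"
proof -
  have "continuous_map I01 I01 (\<lambda>r. 1 - r)"
    unfolding continuous_map_into_I01
    by (intro conjI real_continuous) (auto intro: continuous_map_from_subtopology)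
  then show ?thesis
    using cube_homotopic_reparametrize[OF assms(2,1), of "\<lambda>r. 1 - r" "\<lambda>r. 1 - r"]
    by (auto simp: cube_homotopic_def cube_reverse_def)
qed

lemma concat_reverse:
  assumes n: "0 < n" and u: "u \<in> cube_maps n Z z0"
  shows "cube_homotopic n Z z0 (concat_along 0 n u (cube_reverse n u))
           (\<lambda>s\<in>topspace (unit_cube n). z0)"
    and "cube_homotopic n Z z0 (concat_along 0 n (cube_reverse n u) u)
           (\<lambda>s\<in>topspace (unit_cube n). z0)"
proof -
  have z: "(\<lambda>s\<in>topspace (unit_cube n). u (s(0 := c))) = (\<lambda>s\<in>topspace (unit_cube n). z0)"
    if "c = 0 \<or> c = 1" for c
    using that n cube_boundary_upd[OF _ n that]
    by (auto simp: fun_eq_iff cube_maps_boundary[OF u])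
  have b: "0 \<le> s 0 \<and> s 0 \<le> 1" if "s \<in> topspace (unit_cube n)" for s
    using cube_coord_bounds[OF that n] .
  define \<phi> where "\<phi> = (\<lambda>r::real. min (2 * r) (2 - 2 * r))"
  have "continuous_map I01 I01 \<phi>"
    unfolding \<phi>_def continuous_map_into_I01
    by (intro conjI real_continuous) (auto intro: continuous_map_from_subtopology)
  then have "cube_homotopic n Z z0 (\<lambda>s\<in>topspace (unit_cube n). u (s(0 := \<phi> (s 0))))
      (\<lambda>s\<in>topspace (unit_cube n). u (s(0 := (\<lambda>r. 0) (s 0))))"
    by (intro cube_homotopic_reparametrize u n) (auto simp: \<phi>_def)
  moreover have "(\<lambda>s\<in>topspace (unit_cube n). u (s(0 := \<phi> (s 0)))) =
      concat_along 0 n u (cube_reverse n u)"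
    using b cube_upd_in_topspace[OF _ n]
    by (auto simp: fun_eq_iff concat_along_def cube_reverse_def \<phi>_def min_def)
  ultimately show "cube_homotopic n Z z0 (concat_along 0 n u (cube_reverse n u))
           (\<lambda>s\<in>topspace (unit_cube n). z0)"
    by (simp add: z)
  define \<psi> where "\<psi> = (\<lambda>r::real. max (1 - 2 * r) (2 * r - 1))"
  have \<psi>: "\<psi> r = (if r \<le> 1/2 then 1 - 2 * r else 2 * r - 1)" for r
    by (auto simp: \<psi>_def)
  have "continuous_map I01 I01 \<psi>"
    unfolding \<psi>_def continuous_map_into_I01
    by (intro conjI real_continuous) (auto intro: continuous_map_from_subtopology)
  then have "cube_homotopic n Z z0 (\<lambda>s\<in>topspace (unit_cube n). u (s(0 := \<psi> (s 0))))
      (\<lambda>s\<in>topspace (unit_cube n). u (s(0 := (\<lambda>r. 1) (s 0))))"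
    by (intro cube_homotopic_reparametrize u n) (auto simp: \<psi>_def)
  moreover have "(\<lambda>s\<in>topspace (unit_cube n). u (s(0 := \<psi> (s 0)))) =
      concat_along 0 n (cube_reverse n u) u"
    using b cube_upd_in_topspace[OF _ n]
    by (auto simp: fun_eq_iff concat_along_def cube_reverse_def \<psi>)
  ultimately show "cube_homotopic n Z z0 (concat_along 0 n (cube_reverse n u) u)
           (\<lambda>s\<in>topspace (unit_cube n). z0)"
    by (simp add: z)
qed

lemma concat_interchange:
  assumes "j < n" "k < n" "j \<noteq> k"
  shows "concat_along j n (concat_along k n a b) (concat_along k n c d) =
         concat_along k n (concat_along j n a c) (concat_along j n b d)"
proof
  fix s
  show "concat_along j n (concat_along k n a b) (concat_along k n c d) s =
         concat_along k n (concat_along j n a c) (concat_along j n b d) s"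
  proof (cases "s \<in> topspace (unit_cube n)")
    case True
    have upd: "s(i := r) \<in> topspace (unit_cube n) \<longleftrightarrow> 0 \<le> r \<and> r \<le> 1" if "i < n" for i r
      using True that by (auto simp: topspace_unit_cube extensional_def)
    show ?thesis
      using True assms upd cube_coord_bounds[OF True assms(1)] cube_coord_bounds[OF True assms(2)]
      by (simp add: concat_along_def fun_upd_twist[of j k])
  qed (simp add: concat_along_def)
qed

text \<open>The Eckmann-Hilton argument: pad with constant maps in coordinate 1, interchange the two
  concatenations, and remove the padding in coordinate 0; then go back the other way round.\<close>

lemma concat_commute:
  assumes n: "2 \<le> n" and u: "u \<in> cube_maps n Z z0" and v: "v \<in> cube_maps n Z z0"
  shows "cube_homotopic n Z z0 (concat_along 0 n u v) (concat_along 0 n v u)"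
proof -
  let ?e = "\<lambda>s\<in>topspace (unit_cube n). z0"
  have n0: "0 < n" and n1: "1 < n"
    using n by auto
  note ul = cube_homotopic_sym[OF concat_const_left[OF n1 u]]
    and ur = cube_homotopic_sym[OF concat_const_right[OF n1 u]]
    and vl = cube_homotopic_sym[OF concat_const_left[OF n1 v]]
    and vr = cube_homotopic_sym[OF concat_const_right[OF n1 v]]
  have "cube_homotopic n Z z0 (concat_along 0 n u v)
      (concat_along 0 n (concat_along 1 n u ?e) (concat_along 1 n ?e v))"
    by (rule cube_homotopic_concat[OF n0 ur vl])
  also have "concat_along 0 n (concat_along 1 n u ?e) (concat_along 1 n ?e v) =
      concat_along 1 n (concat_along 0 n u ?e) (concat_along 0 n ?e v)"
    by (rule concat_interchange[OF n0 n1]) simp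
  also have "cube_homotopic n Z z0 \<dots> (concat_along 1 n u v)"
    by (rule cube_homotopic_concat[OF n1 concat_const_right[OF n0 u] concat_const_left[OF n0 v]])
  also have "cube_homotopic n Z z0 \<dots>
      (concat_along 1 n (concat_along 0 n ?e u) (concat_along 0 n v ?e))"
    by (intro cube_homotopic_concat[OF n1] cube_homotopic_sym[OF concat_const_left[OF n0 u]]
        cube_homotopic_sym[OF concat_const_right[OF n0 v]])
  also have "\<dots> = concat_along 0 n (concat_along 1 n ?e v) (concat_along 1 n u ?e)"
    by (rule concat_interchange[OF n1 n0]) simp
  also have "cube_homotopic n Z z0 \<dots> (concat_along 0 n v u)"
    by (rule cube_homotopic_concat[OF n0 concat_const_left[OF n1 v] concat_const_right[OF n1 u]])
  finally show ?thesis .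
qed

section \<open>The homotopy groups\<close>

lemma carrier_homotopy_group: "carrier (homotopy_group n Z z0) = cube_class n Z z0 ` cube_maps n Z z0"
  and one_homotopy_group: "\<one>\<^bsub>homotopy_group n Z z0\<^esub> = cube_class n Z z0 (\<lambda>s\<in>topspace (unit_cube n). z0)"
  by (simp_all add: homotopy_group_def)

lemma mult_homotopy_group:
  assumes n: "0 < n" and u: "u \<in> cube_maps n Z z0" and v: "v \<in> cube_maps n Z z0"
  shows "cube_class n Z z0 u \<otimes>\<^bsub>homotopy_group n Z z0\<^esub> cube_class n Z z0 v =
         cube_class n Z z0 (cube_concat n u v)"
proof -
  have "(\<Union>v'\<in>cube_class n Z z0 v. cube_class n Z z0 (cube_concat n u' v')) =
      cube_class n Z z0 (cube_concat n u' v)" if "u' \<in> cube_maps n Z z0" for u'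
    by (rule Union_cube_class[OF v])
       (auto simp: cube_concat_eq intro!: cube_class_eqI cube_homotopic_concat[OF n]
          cube_homotopic_refl that dest: cube_homotopic_sym)
  then have "(\<Union>u'\<in>cube_class n Z z0 u. \<Union>v'\<in>cube_class n Z z0 v. cube_class n Z z0 (cube_concat n u' v')) =
      (\<Union>u'\<in>cube_class n Z z0 u. cube_class n Z z0 (cube_concat n u' v))"
    by (auto simp: cube_class_def)
  also have "\<dots> = cube_class n Z z0 (cube_concat n u v)"
    by (rule Union_cube_class[OF u])
       (auto simp: cube_concat_eq intro!: cube_class_eqI cube_homotopic_concat[OF n]
          cube_homotopic_refl v dest: cube_homotopic_sym)
  finally show ?thesis
    by (simp add: homotopy_group_def)
qed

lemma group_homotopy_group:
  assumes n: "0 < n" and z0: "z0 \<in> topspace Z"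
  shows "group (homotopy_group n Z z0)"
proof (rule groupI)
  note maps = concat_along_in_maps[OF n]
  note mult = mult_homotopy_group[OF n]
  let ?G = "homotopy_group n Z z0"
  show "\<one>\<^bsub>?G\<^esub> \<in> carrier ?G"
    by (auto simp: carrier_homotopy_group one_homotopy_group cube_maps_const[OF z0])
  show "x \<otimes>\<^bsub>?G\<^esub> y \<in> carrier ?G" if "x \<in> carrier ?G" "y \<in> carrier ?G" for x y
    using that by (auto simp: carrier_homotopy_group mult cube_concat_eq maps)
  show "x \<otimes>\<^bsub>?G\<^esub> y \<otimes>\<^bsub>?G\<^esub> z = x \<otimes>\<^bsub>?G\<^esub> (y \<otimes>\<^bsub>?G\<^esub> z)"
    if xyz: "x \<in> carrier ?G" "y \<in> carrier ?G" "z \<in> carrier ?G" for x y z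
  proof -
    obtain u v w where "u \<in> cube_maps n Z z0" "v \<in> cube_maps n Z z0" "w \<in> cube_maps n Z z0"
      "x = cube_class n Z z0 u" "y = cube_class n Z z0 v" "z = cube_class n Z z0 w"
      using xyz by (auto simp: carrier_homotopy_group)
    then show ?thesis
      by (simp add: mult cube_concat_eq maps cube_class_eqI[OF concat_assoc[OF n]])
  qed
  show "\<one>\<^bsub>?G\<^esub> \<otimes>\<^bsub>?G\<^esub> x = x" if "x \<in> carrier ?G" for x
    using that
    by (auto simp: carrier_homotopy_group one_homotopy_group mult cube_concat_eq maps
        cube_maps_const[OF z0] cube_class_eqI[OF concat_const_left[OF n]])
  show "\<exists>y\<in>carrier ?G. y \<otimes>\<^bsub>?G\<^esub> x = \<one>\<^bsub>?G\<^esub>" if x: "x \<in> carrier ?G" for x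
  proof -
    obtain u where u: "u \<in> cube_maps n Z z0" "x = cube_class n Z z0 u"
      using x by (auto simp: carrier_homotopy_group)
    show ?thesis
      by (rule bexI[of _ "cube_class n Z z0 (cube_reverse n u)"])
         (auto simp: carrier_homotopy_group one_homotopy_group u mult cube_concat_eq
           cube_reverse_in_maps[OF n u(1)] intro!: cube_class_eqI concat_reverse[OF n u(1)])
  qed
qed

lemma inv_homotopy_group:
  assumes n: "0 < n" and z0: "z0 \<in> topspace Z" and u: "u \<in> cube_maps n Z z0"
  shows "inv\<^bsub>homotopy_group n Z z0\<^esub> (cube_class n Z z0 u) = cube_class n Z z0 (cube_reverse n u)"
proof -
  interpret group "homotopy_group n Z z0"
    by (rule group_homotopy_group[OF n z0])
  show ?thesis
    by (rule inv_equality)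
       (auto simp: carrier_homotopy_group one_homotopy_group u mult_homotopy_group[OF n] cube_concat_eq
           cube_reverse_in_maps[OF n u(1)] intro!: cube_class_eqI concat_reverse[OF n u(1)])
qed

lemma comm_group_homotopy_group:
  assumes n: "2 \<le> n" and z0: "z0 \<in> topspace Z"
  shows "comm_group (homotopy_group n Z z0)"
proof (rule group.group_comm_groupI)
  show "group (homotopy_group n Z z0)"
    using n z0 by (intro group_homotopy_group) auto
  have n0: "0 < n" using n by simp
  show "x \<otimes>\<^bsub>homotopy_group n Z z0\<^esub> y = y \<otimes>\<^bsub>homotopy_group n Z z0\<^esub> x"
    if xy: "x \<in> carrier (homotopy_group n Z z0)" "y \<in> carrier (homotopy_group n Z z0)" for x y
  proof -
    obtain u v where "u \<in> cube_maps n Z z0" "v \<in> cube_maps n Z z0"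
      "x = cube_class n Z z0 u" "y = cube_class n Z z0 v"
      using xy by (auto simp: carrier_homotopy_group)
    then show ?thesis
      by (simp add: mult_homotopy_group[OF n0] cube_concat_eq cube_class_eqI[OF concat_commute[OF n]])
  qed
qed

lemma homotopy_group_map_class:
  assumes u: "u \<in> cube_maps n Z z0" and h: "continuous_map Z W h" "h z0 = w0"
  shows "homotopy_group_map n W w0 h (cube_class n Z z0 u) =
         cube_class n W w0 (compose (topspace (unit_cube n)) h u)"
  unfolding homotopy_group_map_def
  by (rule Union_cube_class[OF u])
     (auto intro!: cube_class_eqI cube_homotopic_compose[OF _ h] dest: cube_homotopic_sym)

lemma compose_in_cube_maps:
  assumes u: "u \<in> cube_maps n Z z0" and h: "continuous_map Z W h" "h z0 = w0"
  shows "compose (topspace (unit_cube n)) h u \<in> cube_maps n W w0"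
  using cube_homotopic_compose[OF cube_homotopic_refl[OF u] h] by (rule cube_homotopic_in_maps)

lemma compose_cube_concat:
  assumes "0 < n"
  shows "compose (topspace (unit_cube n)) h (cube_concat n u v) =
         cube_concat n (compose (topspace (unit_cube n)) h u) (compose (topspace (unit_cube n)) h v)"
  using assms cube_coord_bounds[OF _ assms] cube_upd_in_topspace[OF _ assms]
  by (auto simp: fun_eq_iff compose_def cube_concat_def)

lemma homotopy_group_map_hom:
  assumes n: "0 < n" and h: "continuous_map Z W h" "h z0 = w0"
  shows "homotopy_group_map n W w0 h \<in> hom (homotopy_group n Z z0) (homotopy_group n W w0)"
  by (rule homI)
     (auto simp: carrier_homotopy_group homotopy_group_map_class[OF _ h] compose_in_cube_maps[OF _ h]
       mult_homotopy_group[OF n] compose_cube_concat[OF n]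
       concat_along_in_maps[OF n] cube_concat_eq simp flip: compose_cube_concat[OF n, unfolded cube_concat_eq])

section \<open>Mapping spaces\<close>

lemma topspace_mapping_space:
  "topspace (mapping_space U V) = {h \<in> extensional (topspace U). continuous_map U V h}"
proof -
  have "\<exists>K W. compactin U K \<and> openin V W \<and> h ` K \<subseteq> W" for h :: "'a \<Rightarrow> 'b"
    by (rule exI[of _ "{}"]) auto
  then show ?thesis
    unfolding mapping_space_def topology_generated_by_topspace by blast
qed

lemma openin_mapping_space_basic:
  assumes "compactin U K" "openin V W"
  shows "openin (mapping_space U V)
           {h \<in> extensional (topspace U). continuous_map U V h \<and> h ` K \<subseteq> W}"
  unfolding mapping_space_def using assms by (intro topology_generated_by_Basis) blast

lemma continuous_map_into_mapping_space:
  assumes "\<And>t. t \<in> topspace T \<Longrightarrow> g t \<in> topspace (mapping_space U V)"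
    and "\<And>K W. compactin U K \<Longrightarrow> openin V W \<Longrightarrow> openin T {t \<in> topspace T. g t ` K \<subseteq> W}"
  shows "continuous_map T (mapping_space U V) g"
  unfolding mapping_space_def
proof (rule continuous_on_generated_topo)
  let ?S = "{{h \<in> extensional (topspace U). continuous_map U V h \<and> h ` K \<subseteq> W} | K W.
          compactin U K \<and> openin V W}"
  show "g ` topspace T \<subseteq> \<Union>?S"
    using assms(1) unfolding mapping_space_def topology_generated_by_topspace by blast
  fix B assume "B \<in> ?S"
  then obtain K W where KW: "compactin U K" "openin V W"
    and B: "B = {h \<in> extensional (topspace U). continuous_map U V h \<and> h ` K \<subseteq> W}"
    by blast
  have "g -` B \<inter> topspace T = {t \<in> topspace T. g t ` K \<subseteq> W}"
    using assms(1) by (auto simp: B topspace_mapping_space)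
  then show "openin T (g -` B \<inter> topspace T)"
    using assms(2)[OF KW] by simp
qed

text \<open>Currying is continuous for arbitrary spaces, by the tube lemma: the condition that a compact set
  be mapped into an open set is open in the parameter.\<close>

lemma continuous_map_curry:
  assumes F: "continuous_map (prod_topology T U) V (\<lambda>x. F (fst x) (snd x))"
  shows "continuous_map T (mapping_space U V) (\<lambda>t. restrict (F t) (topspace U))"
proof (rule continuous_map_into_mapping_space)
  fix t assume t: "t \<in> topspace T"
  have "continuous_map U V (F t)"
    using continuous_map_comp2[OF F, of U "\<lambda>u. (t, u)"] t by (simp add: continuous_map_paired)
  then show "restrict (F t) (topspace U) \<in> topspace (mapping_space U V)"
    by (auto simp: topspace_mapping_space continuous_map_eq[of _ _ "F t"])
next
  fix K W assume K: "compactin U K" and W: "openin V W"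
  have KU: "K \<subseteq> topspace U"
    using K by (rule compactin_subset_topspace)
  let ?O = "{x \<in> topspace (prod_topology T U). F (fst x) (snd x) \<in> W}"
  have O: "openin (prod_topology T U) ?O"
    by (rule openin_continuous_map_preimage[OF F W])
  show "openin T {t \<in> topspace T. restrict (F t) (topspace U) ` K \<subseteq> W}"
  proof (subst openin_subopen, clarify)
    fix t assume t: "t \<in> topspace T" "restrict (F t) (topspace U) ` K \<subseteq> W"
    have c: "compactin T {t}"
      using t by simp
    have s: "{t} \<times> K \<subseteq> ?O"
      using t KU by (auto simp: image_subset_iff)
    obtain A B where AB: "openin T A" "{t} \<subseteq> A" "K \<subseteq> B" "A \<times> B \<subseteq> ?O"
      by (rule Wallace_theorem_prod_topology[OF c K O s]) blast
    have "F t' u \<in> W" if "t' \<in> A" "u \<in> K" for t' u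
      using subsetD[OF AB(4), of "(t', u)"] AB(3) that by auto
    then show "\<exists>N. openin T N \<and> t \<in> N \<and> N \<subseteq> {t \<in> topspace T. restrict (F t) (topspace U) ` K \<subseteq> W}"
      using AB(1,2) KU openin_subset[OF AB(1)] by (intro exI[of _ A]) auto
  qed
qed

text \<open>The converse needs small compact neighbourhoods in \<open>U\<close>, on which the compact-open topology
  controls the maps.\<close>

lemma continuous_map_uncurry:
  assumes g: "continuous_map T (mapping_space U V) g"
    and U: "locally_compact_space U" "Hausdorff_space U"
  shows "continuous_map (prod_topology T U) V (\<lambda>x. g (fst x) (snd x))"
proof -
  have gt: "continuous_map U V (g t)" if "t \<in> topspace T" for t
    using continuous_map_image_subset_topspace[OF g] that by (auto simp: topspace_mapping_space)
  show ?thesis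
    unfolding continuous_map_def
  proof (intro conjI allI impI)
    show "(\<lambda>x. g (fst x) (snd x)) \<in> topspace (prod_topology T U) \<rightarrow> topspace V"
      using gt by (force simp: continuous_map_def)
    fix W assume W: "openin V W"
    show "openin (prod_topology T U) {x \<in> topspace (prod_topology T U). g (fst x) (snd x) \<in> W}"
    proof (subst openin_subopen, clarify)
      fix t u assume tu: "(t, u) \<in> topspace (prod_topology T U)" "g (fst (t, u)) (snd (t, u)) \<in> W"
      then have t: "t \<in> topspace T" and u: "u \<in> topspace U"
        by auto
      define N where "N = {u \<in> topspace U. g t u \<in> W}"
      have "openin U N" "u \<in> N"
        using openin_continuous_map_preimage[OF gt[OF t] W] tu by (auto simp: N_def)
      moreover have "neighbourhood_base_of (compactin U) U"
        using U locally_compact_space_neighbourhood_base by blast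
      ultimately obtain O' K where K: "openin U O'" "compactin U K" "u \<in> O'" "O' \<subseteq> K" "K \<subseteq> N"
        unfolding neighbourhood_base_of by meson
      define A where "A = {t \<in> topspace T. g t \<in> {h \<in> extensional (topspace U). continuous_map U V h \<and> h ` K \<subseteq> W}}"
      have A: "openin T A"
        unfolding A_def
        by (rule openin_continuous_map_preimage[OF g openin_mapping_space_basic[OF K(2) W]])
      have "g t \<in> extensional (topspace U)"
        using continuous_map_image_subset_topspace[OF g] t by (auto simp: topspace_mapping_space)
      then have tA: "t \<in> A"
        using t K gt[OF t] by (auto simp: A_def N_def)
      show "\<exists>B. openin (prod_topology T U) B \<and> (t, u) \<in> B \<and>
          B \<subseteq> {x \<in> topspace (prod_topology T U). g (fst x) (snd x) \<in> W}"
      proof (intro exI[of _ "A \<times> O'"] conjI)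
        show "openin (prod_topology T U) (A \<times> O')"
          using A K by (simp add: openin_prod_Times_iff)
        show "(t, u) \<in> A \<times> O'"
          using tA K by simp
        show "A \<times> O' \<subseteq> {x \<in> topspace (prod_topology T U). g (fst x) (snd x) \<in> W}"
          using K openin_subset[OF K(1)] by (auto simp: A_def image_subset_iff)
      qed
    qed
  qed
qed

lemma continuous_map_evaluation:
  assumes "u \<in> topspace U"
  shows "continuous_map (mapping_space U V) V (\<lambda>h. h u)"
  unfolding continuous_map_def
proof (intro conjI allI impI)
  show "(\<lambda>h. h u) \<in> topspace (mapping_space U V) \<rightarrow> topspace V"
    using assms by (auto simp: topspace_mapping_space continuous_map_def)
  fix W assume W: "openin V W"
  have "compactin U {u}"
    using assms by simp
  from openin_mapping_space_basic[OF this W]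
  show "openin (mapping_space U V) {h \<in> topspace (mapping_space U V). h u \<in> W}"
    by (simp add: topspace_mapping_space conj_ac)
qed

lemma continuous_map_precompose:
  assumes j: "continuous_map U' U j"
  shows "continuous_map (mapping_space U V) (mapping_space U' V) (\<lambda>h. compose (topspace U') h j)"
proof (rule continuous_map_into_mapping_space)
  fix h assume "h \<in> topspace (mapping_space U V)"
  then have "continuous_map U' V (\<lambda>x. h (j x))"
    by (auto simp: topspace_mapping_space intro: continuous_map_comp2[OF _ j])
  then show "compose (topspace U') h j \<in> topspace (mapping_space U' V)"
    by (auto simp: topspace_mapping_space compose_def continuous_map_eq[of _ _ "\<lambda>x. h (j x)"])
next
  fix K W assume K: "compactin U' K" and W: "openin V W"
  have "{h \<in> topspace (mapping_space U V). compose (topspace U') h j ` K \<subseteq> W} =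
      {h \<in> extensional (topspace U). continuous_map U V h \<and> h ` (j ` K) \<subseteq> W}"
    using compactin_subset_topspace[OF K]
    by (auto simp: topspace_mapping_space compose_def image_subset_iff subset_iff)
  then show "openin (mapping_space U V)
      {h \<in> topspace (mapping_space U V). compose (topspace U') h j ` K \<subseteq> W}"
    using openin_mapping_space_basic[OF image_compactin[OF K j] W] by simp
qed

lemma continuous_map_into_map_component:
  assumes h: "continuous_map T (mapping_space U V) h" and T: "path_connected_space T"
    and t0: "t0 \<in> topspace T" "h t0 = restrict g (topspace U)"
  shows "continuous_map T (map_component U V g) h"
proof -
  have "path_component_of (mapping_space U V) (restrict g (topspace U)) (h t)"
    if "t \<in> topspace T" for t
    using path_component_of_continuous_image[OF h, of t0 t] T t0 that
    by (simp add: path_connected_space_iff_path_component)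
  then show ?thesis
    unfolding map_component_def continuous_map_in_subtopology using h by auto
qed

lemma basepoint_map_component:
  assumes "continuous_map U V g"
  shows "restrict g (topspace U) \<in> topspace (map_component U V g)"
  using assms
  by (auto simp: map_component_def topspace_mapping_space path_component_of_refl
      continuous_map_eq[of _ _ g])

lemma path_connected_map_component: "path_connected_space (map_component U V g)"
  using path_connectedin_path_component_of[of "mapping_space U V" "restrict g (topspace U)"]
  by (simp add: map_component_def path_connectedin_def)

lemma continuous_map_component_to_mapping_space:
  "continuous_map T (map_component U V g) h \<Longrightarrow> continuous_map T (mapping_space U V) h"
  by (simp add: map_component_def continuous_map_in_subtopology)

section \<open>Evaluation subgroups\<close>

lemma path_connected_unit_cube: "path_connected_space (unit_cube n)"
  by (simp add: unit_cube_def path_connected_space_product_topology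
      convex_imp_path_connected)

lemma origin_in_cube_boundary: "0 < n \<Longrightarrow> (\<lambda>i\<in>{..<n}. 0) \<in> cube_boundary n"
  by (auto simp: cube_boundary_iff topspace_unit_cube)

lemma cube_boundary_subset: "s \<in> cube_boundary n \<Longrightarrow> s \<in> topspace (unit_cube n)"
  by (simp add: cube_boundary_iff)

lemma carrier_rel_Gottlieb_group:
  "carrier (rel_Gottlieb_group n V v0 U u0 g) =
     homotopy_group_map n V v0 (\<lambda>h. h u0) `
       carrier (homotopy_group n (map_component U V g) (restrict g (topspace U)))"
  and mult_rel_Gottlieb_group:
    "mult (rel_Gottlieb_group n V v0 U u0 g) = mult (homotopy_group n V v0)"
  and one_rel_Gottlieb_group:
    "one (rel_Gottlieb_group n V v0 U u0 g) = one (homotopy_group n V v0)"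
  by (simp_all add: rel_Gottlieb_group_def)

lemma rel_Gottlieb_group_as_subgroup:
  "rel_Gottlieb_group n V v0 U u0 g =
     homotopy_group n V v0 \<lparr>carrier := carrier (rel_Gottlieb_group n V v0 U u0 g)\<rparr>"
  by (simp add: rel_Gottlieb_group_def)

lemma continuous_map_component_evaluation:
  "u0 \<in> topspace U \<Longrightarrow> continuous_map (map_component U V g) V (\<lambda>h. h u0)"
  unfolding map_component_def by (intro continuous_map_from_subtopology continuous_map_evaluation)

lemma subgroup_rel_Gottlieb_group:
  assumes n: "0 < n" and g: "continuous_map U V g" "u0 \<in> topspace U" "g u0 = v0"
  shows "subgroup (carrier (rel_Gottlieb_group n V v0 U u0 g)) (homotopy_group n V v0)"
proof -
  have v0: "v0 \<in> topspace V"
    using g by (auto simp: continuous_map_def)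
  have "group_hom (homotopy_group n (map_component U V g) (restrict g (topspace U)))
      (homotopy_group n V v0) (homotopy_group_map n V v0 (\<lambda>h. h u0))"
    by (intro group_hom.intro group_hom_axioms.intro group_homotopy_group n v0
        basepoint_map_component g homotopy_group_map_hom continuous_map_component_evaluation)
       (use g in simp)
  then show ?thesis
    unfolding carrier_rel_Gottlieb_group by (rule group_hom.img_is_subgroup)
qed

lemma group_rel_Gottlieb_group:
  assumes n: "0 < n" and g: "continuous_map U V g" "u0 \<in> topspace U" "g u0 = v0"
  shows "group (rel_Gottlieb_group n V v0 U u0 g)"
proof -
  have v0: "v0 \<in> topspace V"
    using g by (auto simp: continuous_map_def)
  show ?thesis
    using subgroup.subgroup_is_group[OF subgroup_rel_Gottlieb_group[OF assms] group_homotopy_group[OF n v0]]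
    by (subst rel_Gottlieb_group_as_subgroup)
qed

lemma comm_group_rel_Gottlieb_group:
  assumes n: "2 \<le> n" and g: "continuous_map U V g" "u0 \<in> topspace U" "g u0 = v0"
  shows "comm_group (rel_Gottlieb_group n V v0 U u0 g)"
proof -
  have v0: "v0 \<in> topspace V"
    using g by (auto simp: continuous_map_def)
  have n0: "0 < n" using n by simp
  interpret comm_group "homotopy_group n V v0"
    by (rule comm_group_homotopy_group[OF n v0])
  show ?thesis
  proof (rule group.group_comm_groupI[OF group_rel_Gottlieb_group[OF n0 g]])
    show "x \<otimes>\<^bsub>rel_Gottlieb_group n V v0 U u0 g\<^esub> y = y \<otimes>\<^bsub>rel_Gottlieb_group n V v0 U u0 g\<^esub> x"
      if "x \<in> carrier (rel_Gottlieb_group n V v0 U u0 g)"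
        "y \<in> carrier (rel_Gottlieb_group n V v0 U u0 g)" for x y
      using that subgroup.subset[OF subgroup_rel_Gottlieb_group[OF n0 g]]
      by (auto simp: mult_rel_Gottlieb_group intro!: m_comm)
  qed
qed

text \<open>An extension of a cube map over \<open>I\<^sup>n \<times> U\<close> is a lift of it to the mapping space.  The lift stays
  in the component of \<open>g\<close> because the cube is path connected and its boundary, which is nonempty for
  \<open>n > 0\<close>, is mapped to \<open>g\<close>.\<close>

lemma rel_Gottlieb_classI:
  assumes n: "0 < n" and g: "continuous_map U V g" "u0 \<in> topspace U" "g u0 = v0"
    and F: "continuous_map (prod_topology (unit_cube n) U) V (\<lambda>x. F (fst x) (snd x))"
    and bd: "\<And>s u. s \<in> cube_boundary n \<Longrightarrow> u \<in> topspace U \<Longrightarrow> F s u = g u"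
  shows "cube_class n V v0 (\<lambda>s\<in>topspace (unit_cube n). F s u0) \<in>
           carrier (rel_Gottlieb_group n V v0 U u0 g)"
proof -
  let ?M = "map_component U V g" and ?g = "restrict g (topspace U)"
  define \<Phi> where "\<Phi> = (\<lambda>s\<in>topspace (unit_cube n). restrict (F s) (topspace U))"
  have b: "restrict (F s) (topspace U) = ?g" if "s \<in> cube_boundary n" for s
    using bd[OF that] by (auto simp: fun_eq_iff)
  have "continuous_map (unit_cube n) ?M (\<lambda>s. restrict (F s) (topspace U))"
    by (rule continuous_map_into_map_component[OF continuous_map_curry[OF F] path_connected_unit_cube])
       (rule cube_boundary_subset[OF origin_in_cube_boundary[OF n]],
        rule b[OF origin_in_cube_boundary[OF n]])
  then have \<Phi>: "\<Phi> \<in> cube_maps n ?M ?g"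
    unfolding \<Phi>_def by (rule cube_mapsI) (rule b)
  have "homotopy_group_map n V v0 (\<lambda>h. h u0) (cube_class n ?M ?g \<Phi>) =
      cube_class n V v0 (compose (topspace (unit_cube n)) (\<lambda>h. h u0) \<Phi>)"
    by (rule homotopy_group_map_class[OF \<Phi> continuous_map_component_evaluation[OF g(2)]])
       (use g in simp)
  also have "compose (topspace (unit_cube n)) (\<lambda>h. h u0) \<Phi> = (\<lambda>s\<in>topspace (unit_cube n). F s u0)"
    using g by (auto simp: compose_def \<Phi>_def fun_eq_iff)
  finally show ?thesis
    unfolding carrier_rel_Gottlieb_group carrier_homotopy_group using \<Phi>
    by (metis image_eqI)
qed

text \<open>The space \<open>U\<close> may fail to be locally compact, so the lift to the mapping space is first composed
  with a map \<open>j\<close> from a locally compact space.  For locally compact \<open>U\<close>, the case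
  \<open>j = id\<close> is the converse of \<open>rel_Gottlieb_classI\<close>.\<close>

lemma rel_Gottlieb_classE:
  assumes n: "0 < n" and g: "u0 \<in> topspace U" "g u0 = v0"
    and a: "a \<in> carrier (rel_Gottlieb_group n V v0 U u0 g)"
    and U': "locally_compact_space U'" "Hausdorff_space U'"
    and j: "continuous_map U' U j" "u0' \<in> topspace U'" "j u0' = u0"
  obtains F where "continuous_map (prod_topology (unit_cube n) U') V (\<lambda>x. F (fst x) (snd x))"
    "\<And>s u. s \<in> cube_boundary n \<Longrightarrow> u \<in> topspace U' \<Longrightarrow> F s u = g (j u)"
    "a = cube_class n V v0 (\<lambda>s\<in>topspace (unit_cube n). F s u0')"
proof -
  let ?M = "map_component U V g" and ?g = "restrict g (topspace U)"
  obtain \<Phi> where \<Phi>: "\<Phi> \<in> cube_maps n ?M ?g"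
    and "a = homotopy_group_map n V v0 (\<lambda>h. h u0) (cube_class n ?M ?g \<Phi>)"
    using a by (auto simp: carrier_rel_Gottlieb_group carrier_homotopy_group)
  then have a: "a = cube_class n V v0 (compose (topspace (unit_cube n)) (\<lambda>h. h u0) \<Phi>)"
    using homotopy_group_map_class[OF \<Phi> continuous_map_component_evaluation[OF g(1)]] g by simp
  have "continuous_map (unit_cube n) (mapping_space U' V) (\<lambda>s. compose (topspace U') (\<Phi> s) j)"
    by (intro continuous_map_comp2[OF continuous_map_precompose[OF j(1)]]
        continuous_map_component_to_mapping_space[OF cube_maps_continuous[OF \<Phi>]])
  from continuous_map_uncurry[OF this U']
  have F: "continuous_map (prod_topology (unit_cube n) U') V (\<lambda>x. \<Phi> (fst x) (j (snd x)))"
    by (rule continuous_map_eq) (auto simp: compose_def)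
  have ju: "j u \<in> topspace U" if "u \<in> topspace U'" for u
    using j(1) that by (auto simp: continuous_map_def)
  show thesis
  proof (rule that[OF F])
    show "\<Phi> s (j u) = g (j u)" if "s \<in> cube_boundary n" "u \<in> topspace U'" for s u
      using cube_maps_boundary[OF \<Phi> that(1)] ju[OF that(2)] by simp
    show "a = cube_class n V v0 (\<lambda>s\<in>topspace (unit_cube n). \<Phi> s (j u0'))"
      using a by (simp add: compose_def j)
  qed
qed

section \<open>Loops parametrized by the unit interval\<close>

definition loop_param :: "real \<Rightarrow> complex" where
  "loop_param t = cis (2 * pi * t)"

text \<open>The inverse of \<open>loop_param\<close> away from the basepoint.  Each of the two formulas is continuous on
  the whole circle; only the passage from one to the other at the basepoint is not.\<close>

definition loop_coord :: "complex \<Rightarrow> real" where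
  "loop_coord z = (if 0 \<le> Im z then arccos (Re z) / (2 * pi) else 1 - arccos (Re z) / (2 * pi))"

lemma topspace_circle: "topspace circle = sphere 0 1"
  by (simp add: circle_def)

lemma loop_param_0 [simp]: "loop_param 0 = 1" and loop_param_1 [simp]: "loop_param 1 = 1"
  by (simp_all add: loop_param_def)

lemma loop_param_in_circle [simp]: "loop_param t \<in> topspace circle"
  by (simp add: topspace_circle loop_param_def)

lemma one_in_circle [simp]: "1 \<in> topspace circle"
  by (simp add: topspace_circle)

lemma loop_coord_1 [simp]: "loop_coord 1 = 0"
  by (simp add: loop_coord_def)

lemma continuous_map_loop_param: "continuous_map I01 circle loop_param"
  unfolding circle_def loop_param_def
  by (auto simp: continuous_map_in_subtopology intro!: continuous_intros)

lemma arccos_Re_circle: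
  assumes "z \<in> topspace circle"
  shows "0 \<le> arccos (Re z) / (2 * pi)" "arccos (Re z) / (2 * pi) \<le> 1/2"
proof -
  have "\<bar>Re z\<bar> \<le> 1"
    using assms abs_Re_le_cmod[of z] by (simp add: topspace_circle)
  then have "0 \<le> arccos (Re z)" "arccos (Re z) \<le> pi"
    by (auto intro: arccos_lbound arccos_ubound)
  then show "0 \<le> arccos (Re z) / (2 * pi)" "arccos (Re z) / (2 * pi) \<le> 1/2"
    by (auto simp: field_simps)
qed

lemma loop_coord_bounds:
  assumes "z \<in> topspace circle"
  shows "0 \<le> loop_coord z \<and> loop_coord z \<le> 1"
  using arccos_Re_circle[OF assms] unfolding loop_coord_def
  by (cases "0 \<le> Im z"; simp only: if_True if_False; linarith)

lemma loop_param_coord [simp]: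
  assumes z: "z \<in> topspace circle"
  shows "loop_param (loop_coord z) = z"
proof -
  have n: "(Re z)\<^sup>2 + (Im z)\<^sup>2 = 1"
    using z by (simp add: topspace_circle cmod_def)
  have r: "\<bar>Re z\<bar> \<le> 1"
    using z abs_Re_le_cmod[of z] by (simp add: topspace_circle)
  have s: "sin (arccos (Re z)) = \<bar>Im z\<bar>"
    using r n by (simp add: sin_arccos_abs algebra_simps flip: real_sqrt_abs)
  show ?thesis
  proof (cases "0 \<le> Im z")
    case True
    then show ?thesis
      using r s by (simp add: loop_param_def loop_coord_def complex_eq_iff cos_arccos_abs)
  next
    case False
    have "2 * pi * loop_coord z = 2 * pi - arccos (Re z)"
      using False by (simp add: loop_coord_def algebra_simps)
    then show ?thesis
      using r s False by (simp add: loop_param_def complex_eq_iff cos_arccos_abs)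
  qed
qed

lemma loop_coord_param:
  assumes "0 < t" "t < 1"
  shows "loop_coord (loop_param t) = t"
proof (cases "t \<le> 1/2")
  case True
  then have "2 * pi * t \<le> pi"
    by simp
  moreover have "0 \<le> 2 * pi * t"
    using assms by simp
  ultimately show ?thesis
    by (simp add: loop_coord_def loop_param_def sin_ge_zero arccos_cos)
next
  case False
  have eq: "2 * pi - 2 * pi * t = 2 * pi * (1 - t)"
    by (simp add: algebra_simps)
  have b: "0 < 2 * pi * (1 - t)" "2 * pi * (1 - t) < pi"
    using assms False by auto
  have "sin (2 * pi * t) = - sin (2 * pi * (1 - t))" "cos (2 * pi * t) = cos (2 * pi * (1 - t))"
    unfolding eq[symmetric] by simp_all
  moreover have "0 < sin (2 * pi * (1 - t))"
    using b by (intro sin_gt_zero)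
  moreover have "arccos (cos (2 * pi * (1 - t))) = 2 * pi * (1 - t)"
    using b by (intro arccos_cos) auto
  ultimately show ?thesis
    by (simp add: loop_coord_def loop_param_def)
qed

text \<open>A family of paths with equal endpoints descends to the circle.  The coordinate on the circle jumps
  at the basepoint, so the map is glued from the two closed half circles, which
  meet there in the common endpoint of the path.\<close>

lemma continuous_map_on_circle:
  assumes \<Phi>: "continuous_map (prod_topology T I01) Z (\<lambda>x. \<Phi> (fst x) (snd x))"
    and eq: "\<And>w. w \<in> topspace T \<Longrightarrow> \<Phi> w 0 = \<Phi> w 1"
  shows "continuous_map (prod_topology T circle) Z (\<lambda>x. \<Phi> (fst x) (loop_coord (snd x)))"
proof -
  let ?T = "prod_topology T circle"
  have arc: "continuous_map circle I01 (\<lambda>z. arccos (Re z) / (2 * pi))"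
    unfolding continuous_map_into_I01
  proof
    have "-1 \<le> Re z \<and> Re z \<le> 1" if "z \<in> sphere 0 1" for z
      using abs_Re_le_cmod[of z] that by auto
    then have "continuous_on (sphere 0 1) (\<lambda>z. arccos (Re z) / (2 * pi))"
      by (intro continuous_intros) auto
    then show "continuous_map circle euclideanreal (\<lambda>z. arccos (Re z) / (2 * pi))"
      by (simp add: circle_def)
    show "\<forall>z\<in>topspace circle. 0 \<le> arccos (Re z) / (2 * pi) \<and> arccos (Re z) / (2 * pi) \<le> 1"
    proof
      show "0 \<le> arccos (Re z) / (2 * pi) \<and> arccos (Re z) / (2 * pi) \<le> 1"
        if "z \<in> topspace circle" for z
        using arccos_Re_circle[OF that] by linarith
    qed
  qed
  have flip: "continuous_map I01 I01 (\<lambda>t. 1 - t)"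
    unfolding continuous_map_into_I01
    by (intro conjI real_continuous) (auto intro: continuous_map_from_subtopology)
  have c: "continuous_map ?T Z (\<lambda>x. \<Phi> (fst x) (h (snd x)))" if "continuous_map circle I01 h" for h
    using continuous_map_comp2[OF \<Phi>, of ?T "\<lambda>x. (fst x, h (snd x))"] that
    by (simp add: continuous_map_paired continuous_map_fst continuous_map_comp2[OF that continuous_map_snd])
  have im: "continuous_map ?T euclideanreal (\<lambda>x. Im (snd x))"
    by (rule continuous_map_comp2[OF _ continuous_map_snd]) (auto simp: circle_def intro!: continuous_intros)
  have "continuous_map ?T Z (\<lambda>x. if 0 \<le> Im (snd x)
      then \<Phi> (fst x) (arccos (Re (snd x)) / (2 * pi)) else \<Phi> (fst x) (1 - arccos (Re (snd x)) / (2 * pi)))"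
  proof (rule continuous_map_cases_le)
    fix x assume x: "x \<in> topspace ?T" and 0: "0 = Im (snd x)"
    then have "Re (snd x) = 1 \<or> Re (snd x) = -1"
      by (auto simp: topspace_circle cmod_def real_sqrt_eq_1_iff power2_eq_1_iff)
    then show "\<Phi> (fst x) (arccos (Re (snd x)) / (2 * pi)) = \<Phi> (fst x) (1 - arccos (Re (snd x)) / (2 * pi))"
      using eq x by auto
  qed (use im c[OF arc] c[OF continuous_map_comp2[OF flip arc]] in \<open>auto intro: continuous_map_from_subtopology\<close>)
  then show ?thesis
    by (rule continuous_map_eq) (auto simp: loop_coord_def)
qed

lemma locally_compact_circle: "locally_compact_space circle"
  unfolding circle_def
  by (intro compact_imp_locally_compact_space) (simp add: compact_space_subtopology)

lemma Hausdorff_circle: "Hausdorff_space circle"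
  unfolding circle_def by (intro Hausdorff_space_subtopology) simp

section \<open>Maps into and out of loop spaces\<close>

lemma restrict_const_loop [simp]: "restrict (const_loop y) (topspace circle) = const_loop y"
  by (simp add: const_loop_def)

lemma continuous_map_into_null_loop_space:
  assumes \<Gamma>: "continuous_map (prod_topology T circle) Y (\<lambda>x. \<Gamma> (fst x) (snd x))"
    and T: "path_connected_space T" "w0 \<in> topspace T"
    and w0: "\<And>z. z \<in> topspace circle \<Longrightarrow> \<Gamma> w0 z = y0"
  shows "continuous_map T (null_loop_space Y y0) (\<lambda>w. restrict (\<Gamma> w) (topspace circle))"
  unfolding null_loop_space_def
  by (rule continuous_map_into_map_component[OF continuous_map_curry[OF \<Gamma>] T])
     (use w0 in \<open>auto simp: const_loop_def fun_eq_iff\<close>)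

lemma continuous_map_loop_evaluation:
  assumes "continuous_map T (null_loop_space Y y0) \<gamma>"
  shows "continuous_map (prod_topology T circle) Y (\<lambda>x. \<gamma> (fst x) (snd x))"
  using assms unfolding null_loop_space_def
  by (intro continuous_map_uncurry[OF continuous_map_component_to_mapping_space
      locally_compact_circle Hausdorff_circle])

text \<open>The loops belong to the component of the constant loops since the parameter space is path
  connected and one of the loops is constant.\<close>

lemma continuous_map_into_rel_loop_space:
  assumes \<Gamma>: "continuous_map (prod_topology T I01) Y (\<lambda>x. \<Gamma> (fst x) (snd x))"
    and \<xi>: "continuous_map T X \<xi>"
    and ends: "\<And>w. w \<in> topspace T \<Longrightarrow> \<Gamma> w 0 = f (\<xi> w)" "\<And>w. w \<in> topspace T \<Longrightarrow> \<Gamma> w 1 = f (\<xi> w)"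
    and T: "path_connected_space T" "w0 \<in> topspace T"
    and w0: "\<And>t. 0 \<le> t \<Longrightarrow> t \<le> 1 \<Longrightarrow> \<Gamma> w0 t = y0"
  shows "continuous_map T (rel_loop_space X Y y0 f) (\<lambda>w. (\<xi> w, \<lambda>z\<in>topspace circle. \<Gamma> w (loop_coord z)))"
proof -
  have "continuous_map (prod_topology T circle) Y (\<lambda>x. \<Gamma> (fst x) (loop_coord (snd x)))"
    by (rule continuous_map_on_circle[OF \<Gamma>]) (use ends in simp)
  from continuous_map_into_null_loop_space[OF this T]
  have "continuous_map T (null_loop_space Y y0) (\<lambda>w. \<lambda>z\<in>topspace circle. \<Gamma> w (loop_coord z))"
    using w0 loop_coord_bounds by simp
  then show ?thesis
    using ends \<xi> by (auto simp: rel_loop_space_def continuous_map_in_subtopology continuous_map_paired)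
qed

lemma continuous_map_from_rel_loop_space:
  assumes N: "continuous_map T (rel_loop_space X Y y0 f) N"
  shows "continuous_map T X (\<lambda>w. fst (N w))"
    and "continuous_map (prod_topology T I01) Y (\<lambda>x. snd (N (fst x)) (loop_param (snd x)))"
    and "w \<in> topspace T \<Longrightarrow> snd (N w) 1 = f (fst (N w))"
proof -
  have N': "continuous_map T (prod_topology X (null_loop_space Y y0)) N"
    and eq: "N \<in> topspace T \<rightarrow> {(x, \<gamma>). f x = \<gamma> 1}"
    using N by (auto simp: rel_loop_space_def continuous_map_in_subtopology)
  show "continuous_map T X (\<lambda>w. fst (N w))"
    using N' by (rule continuous_map_comp2[OF continuous_map_fst])
  have "continuous_map T (null_loop_space Y y0) (\<lambda>w. snd (N w))"
    using N' by (rule continuous_map_comp2[OF continuous_map_snd])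
  from continuous_map_comp2[OF continuous_map_loop_evaluation[OF this],
      of "prod_topology T I01" "\<lambda>x. (fst x, loop_param (snd x))"]
  show "continuous_map (prod_topology T I01) Y (\<lambda>x. snd (N (fst x)) (loop_param (snd x)))"
    by (simp add: continuous_map_paired continuous_map_fst
        continuous_map_comp2[OF continuous_map_loop_param continuous_map_snd])
  show "snd (N w) 1 = f (fst (N w))" if "w \<in> topspace T"
    using funcset_mem[OF eq that] by (simp add: case_prod_beta)
qed

lemma rel_loop_space_loop_extensional:
  "(x, \<gamma>) \<in> topspace (rel_loop_space X Y y0 f) \<Longrightarrow> \<gamma> \<in> extensional (topspace circle)"
  by (auto simp: rel_loop_space_def null_loop_space_def map_component_def topspace_mapping_space)

lemma path_connected_null_loop_space: "path_connected_space (null_loop_space Y y0)"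
  by (simp add: null_loop_space_def path_connected_map_component)

lemma const_loop_in_null_loop_space:
  assumes "y0 \<in> topspace Y"
  shows "const_loop y0 \<in> topspace (null_loop_space Y y0)"
proof -
  have "continuous_map circle Y (const_loop y0)"
    using assms by (simp add: const_loop_def continuous_map_eq[of _ _ "\<lambda>z. y0"])
  from basepoint_map_component[OF this] show ?thesis
    by (simp add: null_loop_space_def)
qed

lemma continuous_map_const_loop:
  assumes "path_connected_space Y" "y0 \<in> topspace Y"
  shows "continuous_map Y (null_loop_space Y y0) const_loop"
  using continuous_map_into_null_loop_space[of Y Y "\<lambda>y z. y" y0 y0] assms
  by (simp add: const_loop_def[abs_def] continuous_map_fst)

lemma continuous_map_canonical_loop_map:
  assumes f: "continuous_map X Y f" "f x0 = y0" and x0: "x0 \<in> topspace X"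
  shows "continuous_map (null_loop_space X x0) (rel_loop_space X Y y0 f) (canonical_loop_map f)"
proof -
  let ?T = "null_loop_space X x0"
  have ev: "continuous_map (prod_topology ?T circle) X (\<lambda>x. fst x (snd x))"
    using continuous_map_loop_evaluation[OF continuous_map_id[of ?T]] by simp
  have "continuous_map ?T (rel_loop_space X Y y0 f)
      (\<lambda>\<alpha>. (\<alpha> 1, \<lambda>z\<in>topspace circle. f (\<alpha> (loop_param (loop_coord z)))))"
  proof (rule continuous_map_into_rel_loop_space)
    have "continuous_map (prod_topology ?T I01) X (\<lambda>x. fst x (loop_param (snd x)))"
      using continuous_map_comp2[OF ev, of "prod_topology ?T I01" "\<lambda>x. (fst x, loop_param (snd x))"]
      by (simp add: continuous_map_paired continuous_map_fst
          continuous_map_comp2[OF continuous_map_loop_param continuous_map_snd])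
    then show "continuous_map (prod_topology ?T I01) Y (\<lambda>x. f (fst x (loop_param (snd x))))"
      by (rule continuous_map_comp2[OF f(1)])
    show "continuous_map ?T X (\<lambda>\<alpha>. \<alpha> 1)"
      using continuous_map_comp2[OF ev, of ?T "\<lambda>\<alpha>. (\<alpha>, 1)"] by (simp add: continuous_map_paired)
    show "path_connected_space ?T"
      by (rule path_connected_null_loop_space)
    show "const_loop x0 \<in> topspace ?T"
      by (rule const_loop_in_null_loop_space[OF x0])
  qed (use f in \<open>auto simp: const_loop_def\<close>)
  then show ?thesis
    by (rule continuous_map_eq) (auto simp: canonical_loop_map_def compose_def)
qed

lemma canonical_loop_map_const_loop: "canonical_loop_map f (const_loop x) = (x, const_loop (f x))"
  by (auto simp: canonical_loop_map_def const_loop_def compose_def)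

section \<open>Adding a coordinate to a cube\<close>

lemma continuous_map_cube_extend:
  assumes "continuous_map T (unit_cube n) g" "continuous_map T I01 h"
  shows "continuous_map T (unit_cube (Suc n)) (\<lambda>x. (g x)(n := h x))"
  unfolding unit_cube_def continuous_map_componentwise
proof (intro conjI ballI)
  show "(\<lambda>x. (g x)(n := h x)) ` topspace T \<subseteq> extensional {..<Suc n}"
    using assms by (auto simp: unit_cube_def continuous_map_componentwise extensional_def)
  show "continuous_map T I01 (\<lambda>x. ((g x)(n := h x)) k)" if "k \<in> {..<Suc n}" for k
    using assms that by (cases "k = n") (auto simp: unit_cube_def continuous_map_componentwise)
qed

lemma continuous_map_cube_restrict:
  assumes "continuous_map T (unit_cube (Suc n)) g"
  shows "continuous_map T (unit_cube n) (\<lambda>x. restrict (g x) {..<n})"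
  using assms unfolding unit_cube_def continuous_map_componentwise by auto

lemma cube_extend_in_topspace:
  "s \<in> topspace (unit_cube n) \<Longrightarrow> 0 \<le> t \<Longrightarrow> t \<le> 1 \<Longrightarrow> s(n := t) \<in> topspace (unit_cube (Suc n))"
  by (auto simp: topspace_unit_cube extensional_def less_Suc_eq)

lemma cube_extend_boundary:
  "s \<in> cube_boundary n \<Longrightarrow> 0 \<le> t \<Longrightarrow> t \<le> 1 \<Longrightarrow> s(n := t) \<in> cube_boundary (Suc n)"
  unfolding cube_boundary_iff using cube_extend_in_topspace
  by (metis fun_upd_other less_SucI order_less_irrefl)

lemma cube_extend_end_boundary:
  "s \<in> topspace (unit_cube n) \<Longrightarrow> t = 0 \<or> t = 1 \<Longrightarrow> s(n := t) \<in> cube_boundary (Suc n)"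
  using cube_extend_in_topspace[of s n t] by (auto simp: cube_boundary_iff)

lemma cube_restrict_in_topspace:
  "s \<in> topspace (unit_cube (Suc n)) \<Longrightarrow> restrict s {..<n} \<in> topspace (unit_cube n)"
  by (auto simp: topspace_unit_cube)

lemma cube_restrict_boundary:
  assumes "s \<in> cube_boundary (Suc n)"
  shows "restrict s {..<n} \<in> cube_boundary n \<or> s n = 0 \<or> s n = 1"
  using assms cube_restrict_in_topspace[of s n] by (auto simp: cube_boundary_iff less_Suc_eq)

lemma cube_restrict_extend:
  "s \<in> topspace (unit_cube (Suc n)) \<Longrightarrow> (restrict s {..<n})(n := s n) = s"
  by (auto simp: topspace_unit_cube fun_eq_iff extensional_def)

lemma cube_extend_restrict:
  "s \<in> topspace (unit_cube n) \<Longrightarrow> restrict (s(n := t)) {..<n} = s"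
  by (auto simp: topspace_unit_cube fun_eq_iff extensional_def)

section \<open>The inclusion of the fibre\<close>

text \<open>The inclusion of the based loops of \<open>Y\<close> as the fibre over \<open>x0\<close>, on representatives: the last
  coordinate of the cube becomes the loop parameter.  Concatenation happens in coordinate 0, which is
  a different one if \<open>n > 0\<close>.\<close>

definition loop_adjoint ::
    "nat \<Rightarrow> 'a \<Rightarrow> ((nat \<Rightarrow> real) \<Rightarrow> 'b) \<Rightarrow> (nat \<Rightarrow> real) \<Rightarrow> 'a \<times> (complex \<Rightarrow> 'b)" where
  "loop_adjoint n x0 u =
     (\<lambda>s\<in>topspace (unit_cube n). (x0, \<lambda>z\<in>topspace circle. u (s(n := loop_coord z))))"

locale pointed_map =
  fixes X :: "'a topology" and x0 :: 'a and Y :: "'b topology" and y0 :: 'b and f :: "'a \<Rightarrow> 'b"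
  assumes f: "continuous_map X Y f" and fx0: "f x0 = y0" and x0: "x0 \<in> topspace X"
    and pcX: "path_connected_space X" and lcX: "locally_compact_space X" and T2X: "Hausdorff_space X"
begin

abbreviation L where "L \<equiv> rel_loop_space X Y y0 f"
abbreviation l0 where "l0 \<equiv> (x0, const_loop y0)"
abbreviation LX where "LX \<equiv> null_loop_space X x0"

lemma y0: "y0 \<in> topspace Y"
  using f fx0 x0 by (auto simp: continuous_map_def)

lemma canonical_continuous: "continuous_map LX L (canonical_loop_map f)"
  by (rule continuous_map_canonical_loop_map[OF f fx0 x0])

lemma canonical_basepoint: "canonical_loop_map f (const_loop x0) = l0"
  by (simp add: canonical_loop_map_const_loop fx0)

lemma const_loop_in_LX: "const_loop x0 \<in> topspace LX"
  by (rule const_loop_in_null_loop_space[OF x0])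

lemma l0: "l0 \<in> topspace L"
  using canonical_continuous const_loop_in_LX canonical_basepoint
  by (metis continuous_map_image_subset_topspace image_subset_iff)

text \<open>Homotopies of cubes in \<open>L\<^sub>fY\<close> are given by their components, with the loops written as paths on
  the unit interval, so that formulas for them need not mention the circle.\<close>

lemma cube_homotopic_in_rel_loop_space:
  assumes n: "0 < n"
    and \<Gamma>: "continuous_map (prod_topology (prod_topology I01 (unit_cube n)) I01) Y
              (\<lambda>x. \<Gamma> (fst (fst x)) (snd (fst x)) (snd x))"
    and \<xi>: "continuous_map (prod_topology I01 (unit_cube n)) X (\<lambda>x. \<xi> (fst x) (snd x))"
    and ends: "\<And>\<tau> s. 0 \<le> \<tau> \<Longrightarrow> \<tau> \<le> 1 \<Longrightarrow> s \<in> topspace (unit_cube n) \<Longrightarrow> \<Gamma> \<tau> s 0 = f (\<xi> \<tau> s)"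
      "\<And>\<tau> s. 0 \<le> \<tau> \<Longrightarrow> \<tau> \<le> 1 \<Longrightarrow> s \<in> topspace (unit_cube n) \<Longrightarrow> \<Gamma> \<tau> s 1 = f (\<xi> \<tau> s)"
    and bd: "\<And>\<tau> s. 0 \<le> \<tau> \<Longrightarrow> \<tau> \<le> 1 \<Longrightarrow> s \<in> cube_boundary n \<Longrightarrow> \<xi> \<tau> s = x0"
      "\<And>\<tau> s t. 0 \<le> \<tau> \<Longrightarrow> \<tau> \<le> 1 \<Longrightarrow> s \<in> cube_boundary n \<Longrightarrow> 0 \<le> t \<Longrightarrow> t \<le> 1 \<Longrightarrow> \<Gamma> \<tau> s t = y0"
    and u: "u \<in> extensional (topspace (unit_cube n))"
      "\<And>s. s \<in> topspace (unit_cube n) \<Longrightarrow> u s = (\<xi> 0 s, \<lambda>z\<in>topspace circle. \<Gamma> 0 s (loop_coord z))"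
    and v: "v \<in> extensional (topspace (unit_cube n))"
      "\<And>s. s \<in> topspace (unit_cube n) \<Longrightarrow> v s = (\<xi> 1 s, \<lambda>z\<in>topspace circle. \<Gamma> 1 s (loop_coord z))"
  shows "cube_homotopic n L l0 u v"
proof (rule cube_homotopicI[where H = "\<lambda>\<tau> s. (\<xi> \<tau> s, \<lambda>z\<in>topspace circle. \<Gamma> \<tau> s (loop_coord z))"])
  let ?T = "prod_topology I01 (unit_cube n)"
  have o: "(\<lambda>i\<in>{..<n}. 0) \<in> cube_boundary n"
    by (rule origin_in_cube_boundary[OF n])
  show "continuous_map ?T L (\<lambda>x. (\<xi> (fst x) (snd x), \<lambda>z\<in>topspace circle. \<Gamma> (fst x) (snd x) (loop_coord z)))"
  proof (rule continuous_map_into_rel_loop_space[where \<Gamma> = "\<lambda>w. \<Gamma> (fst w) (snd w)", OF \<Gamma> \<xi>])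
    show "path_connected_space ?T"
      by (simp add: path_connected_space_prod_topology path_connected_unit_cube convex_imp_path_connected)
    show "(0, \<lambda>i\<in>{..<n}. 0) \<in> topspace ?T"
      using cube_boundary_subset[OF o] by simp
    show "\<Gamma> (fst (0, \<lambda>i\<in>{..<n}. 0)) (snd (0, \<lambda>i\<in>{..<n}. 0)) t = y0" if "0 \<le> t" "t \<le> 1" for t
      using bd(2)[OF _ _ o that] by simp
  qed (use ends in auto)
  show "(\<xi> \<tau> s, \<lambda>z\<in>topspace circle. \<Gamma> \<tau> s (loop_coord z)) = l0"
    if "0 \<le> \<tau>" "\<tau> \<le> 1" "s \<in> cube_boundary n" for \<tau> s
    using bd[OF that] loop_coord_bounds by (auto simp: const_loop_def fun_eq_iff)
qed (use u v in auto)

lemma loop_adjoint_homotopic: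
  assumes n: "0 < n" and uv: "cube_homotopic (Suc n) Y y0 u v"
  shows "cube_homotopic n L l0 (loop_adjoint n x0 u) (loop_adjoint n x0 v)"
proof -
  obtain U where U: "continuous_map (prod_topology I01 (unit_cube (Suc n))) Y (\<lambda>x. U (fst x) (snd x))"
    "\<And>t s. 0 \<le> t \<Longrightarrow> t \<le> 1 \<Longrightarrow> s \<in> cube_boundary (Suc n) \<Longrightarrow> U t s = y0"
    "\<And>s. s \<in> topspace (unit_cube (Suc n)) \<Longrightarrow> U 0 s = u s"
    "\<And>s. s \<in> topspace (unit_cube (Suc n)) \<Longrightarrow> U 1 s = v s"
    by (rule cube_homotopicE[OF uv]) blast
  let ?T = "prod_topology (prod_topology I01 (unit_cube n)) I01"
  show ?thesis
  proof (rule cube_homotopic_in_rel_loop_space[OF n,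
        where \<Gamma> = "\<lambda>\<tau> s t. U \<tau> (s(n := t))" and \<xi> = "\<lambda>\<tau> s. x0"])
    have "continuous_map ?T (prod_topology I01 (unit_cube (Suc n)))
        (\<lambda>x. (fst (fst x), (snd (fst x))(n := snd x)))"
      by (intro continuous_map_pairedI continuous_map_cube_extend continuous_map_snd
          continuous_map_comp2[OF continuous_map_fst continuous_map_fst]
          continuous_map_comp2[OF continuous_map_snd continuous_map_fst])
    from continuous_map_comp2[OF U(1) this]
    show "continuous_map ?T Y (\<lambda>x. U (fst (fst x)) ((snd (fst x))(n := snd x)))"
      by simp
  qed (use U cube_extend_end_boundary cube_extend_boundary cube_extend_in_topspace loop_coord_bounds fx0 x0
       in \<open>auto simp: loop_adjoint_def fun_eq_iff\<close>)
qed

lemma loop_adjoint_in_maps: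
  "0 < n \<Longrightarrow> u \<in> cube_maps (Suc n) Y y0 \<Longrightarrow> loop_adjoint n x0 u \<in> cube_maps n L l0"
  by (rule cube_homotopic_in_maps(1)[OF loop_adjoint_homotopic[OF _ cube_homotopic_refl]])

lemma loop_adjoint_concat:
  assumes n: "0 < n"
  shows "loop_adjoint n x0 (cube_concat (Suc n) u v) =
         cube_concat n (loop_adjoint n x0 u) (loop_adjoint n x0 v)"
proof
  fix s
  show "loop_adjoint n x0 (cube_concat (Suc n) u v) s =
         cube_concat n (loop_adjoint n x0 u) (loop_adjoint n x0 v) s"
  proof (cases "s \<in> topspace (unit_cube n)")
    case True
    have "s(0 := r) \<in> topspace (unit_cube n) \<longleftrightarrow> 0 \<le> r \<and> r \<le> 1" for r
      using True n by (auto simp: topspace_unit_cube extensional_def)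
    moreover have "cube_concat (Suc n) u v (s(n := t)) =
        (if s 0 \<le> 1/2 then u (s(0 := 2 * s 0, n := t)) else v (s(0 := 2 * s 0 - 1, n := t)))"
      if "0 \<le> t" "t \<le> 1" for t
      using cube_extend_in_topspace[OF True that] n by (simp add: cube_concat_def fun_upd_twist[of n 0])
    ultimately show ?thesis
      using True cube_coord_bounds[OF True n] loop_coord_bounds
      by (simp add: loop_adjoint_def cube_concat_def cong: restrict_cong)
  qed (simp add: loop_adjoint_def cube_concat_def)
qed

definition loop_class_map ::
    "nat \<Rightarrow> ((nat \<Rightarrow> real) \<Rightarrow> 'b) set \<Rightarrow> ((nat \<Rightarrow> real) \<Rightarrow> 'a \<times> (complex \<Rightarrow> 'b)) set" where
  "loop_class_map n a = (\<Union>u\<in>a. cube_class n L l0 (loop_adjoint n x0 u))"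

lemma loop_class_map_class:
  assumes "0 < n" "u \<in> cube_maps (Suc n) Y y0"
  shows "loop_class_map n (cube_class (Suc n) Y y0 u) = cube_class n L l0 (loop_adjoint n x0 u)"
  unfolding loop_class_map_def
  by (rule Union_cube_class[OF assms(2)])
     (metis cube_class_eqI cube_homotopic_sym loop_adjoint_homotopic[OF assms(1)])

lemma loop_class_map_hom:
  assumes n: "0 < n"
  shows "loop_class_map n \<in> hom (homotopy_group (Suc n) Y y0) (homotopy_group n L l0)"
  by (rule homI)
     (auto simp: carrier_homotopy_group loop_class_map_class[OF n] loop_adjoint_in_maps[OF n]
       mult_homotopy_group n loop_adjoint_concat[OF n, unfolded cube_concat_eq]
       concat_along_in_maps cube_concat_eq)

text \<open>A null homotopy in \<open>L\<^sub>fY\<close> consists of loops \<open>\<Gamma> \<tau> s\<close> in \<open>Y\<close> with moving endpoints \<open>f (\<xi> \<tau> s)\<close>.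
  In the square of pairs \<open>(\<tau>, t)\<close> the bottom edge carries \<open>u\<close>, the top edge is constant, and the two
  vertical edges carry the same path.  The first homotopy \<open>H1\<close> pushes the bottom edge through the
  square onto the other three edges; the second one, \<open>H2\<close>, retracts the resulting path, which goes up
  and down again along \<open>f \<circ> \<xi>\<close>.  The tent function \<open>min (3 * t) (3 - 3 * t)\<close> is the height reached
  at time \<open>t\<close>; it is at least 1 exactly in the middle third, where \<open>H1 1\<close> runs along the top edge.\<close>

lemma loop_adjoint_null:
  assumes n: "0 < n" and u: "u \<in> cube_maps (Suc n) Y y0"
    and null: "cube_homotopic n L l0 (loop_adjoint n x0 u) (\<lambda>s\<in>topspace (unit_cube n). l0)"
  shows "cube_homotopic (Suc n) Y y0 u (\<lambda>s\<in>topspace (unit_cube (Suc n)). y0)"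
proof -
  obtain N where N: "continuous_map (prod_topology I01 (unit_cube n)) L (\<lambda>x. N (fst x) (snd x))"
    and Nbd: "\<And>\<tau> s. 0 \<le> \<tau> \<Longrightarrow> \<tau> \<le> 1 \<Longrightarrow> s \<in> cube_boundary n \<Longrightarrow> N \<tau> s = l0"
    and N0: "\<And>s. s \<in> topspace (unit_cube n) \<Longrightarrow> N 0 s = loop_adjoint n x0 u s"
    and N1: "\<And>s. s \<in> topspace (unit_cube n) \<Longrightarrow> N 1 s = l0"
    by (rule cube_homotopicE[OF null]) auto
  define \<Gamma> where "\<Gamma> = (\<lambda>\<tau> s t. snd (N \<tau> s) (loop_param t))"
  define \<xi> where "\<xi> = (\<lambda>\<tau> s. fst (N \<tau> s))"
  note N' = continuous_map_from_rel_loop_space[OF N]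
  have \<xi>: "continuous_map (prod_topology I01 (unit_cube n)) X (\<lambda>x. \<xi> (fst x) (snd x))"
    using N'(1) by (simp add: \<xi>_def)
  have \<Gamma>: "continuous_map (prod_topology (prod_topology I01 (unit_cube n)) I01) Y
              (\<lambda>x. \<Gamma> (fst (fst x)) (snd (fst x)) (snd x))"
    using N'(2) by (simp add: \<Gamma>_def)
  have ends: "\<Gamma> \<tau> s 0 = f (\<xi> \<tau> s)" "\<Gamma> \<tau> s 1 = f (\<xi> \<tau> s)"
    if "0 \<le> \<tau>" "\<tau> \<le> 1" "s \<in> topspace (unit_cube n)" for \<tau> s
    using N'(3)[of "(\<tau>, s)"] that by (auto simp: \<Gamma>_def \<xi>_def)
  have at_l0: "\<xi> \<tau> s = x0 \<and> \<Gamma> \<tau> s t = y0" if "N \<tau> s = l0" for \<tau> s t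
    using that by (simp add: \<xi>_def \<Gamma>_def const_loop_def)
  have \<xi>0: "\<xi> 0 s = x0" if "s \<in> topspace (unit_cube n)" for s
    using N0[OF that] that by (simp add: \<xi>_def loop_adjoint_def)
  let ?T = "prod_topology I01 (unit_cube (Suc n))"
  let ?w = "\<lambda>s. min (3 * s n) (3 - 3 * s n)"
  have cf: "continuous_map ?T euclideanreal fst"
    using continuous_map_fst[of I01 "unit_cube (Suc n)"] by (simp add: continuous_map_into_I01)
  have cn: "continuous_map ?T euclideanreal (\<lambda>x. snd x n)"
    by (rule continuous_map_cube_coord[OF continuous_map_snd]) simp
  have cr: "continuous_map ?T (unit_cube n) (\<lambda>x. restrict (snd x) {..<n})"
    by (rule continuous_map_cube_restrict[OF continuous_map_snd])
  define H1 where "H1 = (\<lambda>\<sigma> s. \<Gamma> (clip (min \<sigma> (?w s))) (restrict s {..<n}) (clip ((1 + 2 * \<sigma>) * s n - \<sigma>)))"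
  define H2 where "H2 = (\<lambda>\<sigma> s. f (\<xi> (clip (min (1 - \<sigma>) (?w s))) (restrict s {..<n})))"
  have H12: "H1 1 s = H2 0 s" if s: "s \<in> topspace (unit_cube (Suc n))" for s
  proof -
    have r: "restrict s {..<n} \<in> topspace (unit_cube n)"
      by (rule cube_restrict_in_topspace[OF s])
    consider "s n \<le> 1/3" | "1/3 \<le> s n" "s n \<le> 2/3" | "2/3 \<le> s n"
      by linarith
    then show ?thesis
    proof cases
      case 2
      then have "min 1 (?w s) = 1" by auto
      then show ?thesis
        using at_l0[OF N1[OF r]] by (simp add: H1_def H2_def fx0)
    qed (use ends r in \<open>auto simp: H1_def H2_def\<close>)
  qed
  have "cube_homotopic (Suc n) Y y0 u (\<lambda>s\<in>topspace (unit_cube (Suc n)). H1 1 s)"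
  proof (rule cube_homotopicI[where H = H1])
    have "continuous_map ?T (prod_topology (prod_topology I01 (unit_cube n)) I01)
        (\<lambda>x. ((clip (min (fst x) (?w (snd x))), restrict (snd x) {..<n}),
              clip ((1 + 2 * fst x) * snd x n - fst x)))"
      by (intro continuous_map_pairedI continuous_map_clip_I01 real_continuous cf cn cr)
    from continuous_map_comp2[OF \<Gamma> this]
    show "continuous_map ?T Y (\<lambda>x. H1 (fst x) (snd x))"
      by (simp add: H1_def)
    show "H1 \<sigma> s = y0" if "0 \<le> \<sigma>" "\<sigma> \<le> 1" and s: "s \<in> cube_boundary (Suc n)" for \<sigma> s
      using cube_restrict_boundary[OF s]
    proof (elim disjE)
      assume "restrict s {..<n} \<in> cube_boundary n"
      then show ?thesis
        using at_l0[OF Nbd] by (simp add: H1_def)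
    next
      have r: "restrict s {..<n} \<in> topspace (unit_cube n)"
        by (rule cube_restrict_in_topspace[OF cube_boundary_subset[OF s]])
      { assume "s n = 0"
        then show ?thesis
          using that ends[OF _ _ r, of 0] \<xi>0[OF r] by (simp add: H1_def fx0) }
      { assume "s n = 1"
        then show ?thesis
          using that ends[OF _ _ r, of 0] \<xi>0[OF r] by (simp add: H1_def fx0) }
    qed
    show "u \<in> extensional (topspace (unit_cube (Suc n)))"
      by (rule cube_maps_extensional[OF u])
    show "H1 0 s = u s" if s: "s \<in> topspace (unit_cube (Suc n))" for s
    proof -
      let ?r = "restrict s {..<n}"
      have r: "?r \<in> topspace (unit_cube n)"
        by (rule cube_restrict_in_topspace[OF s])
      have sn: "0 \<le> s n" "s n \<le> 1"
        using cube_coord_bounds[OF s] by auto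
      have "min 0 (?w s) = 0"
        using sn by auto
      then have *: "H1 0 s = u (?r(n := loop_coord (loop_param (s n))))"
        using sn r by (simp add: H1_def \<Gamma>_def N0 loop_adjoint_def)
      show ?thesis
      proof (cases "0 < s n \<and> s n < 1")
        case True
        then show ?thesis
          using * by (simp add: loop_coord_param cube_restrict_extend[OF s] del: fun_upd_apply)
      next
        case False
        then have e: "s n = 0 \<or> s n = 1"
          using sn by auto
        then have "u (?r(n := 0)) = y0" "s \<in> cube_boundary (Suc n)"
          using cube_maps_boundary[OF u] cube_extend_end_boundary[OF r, of 0] s
          by (auto simp: cube_boundary_iff)
        then show ?thesis
          using * e cube_maps_boundary[OF u] by auto
      qed
    qed
  qed auto
  also have "cube_homotopic (Suc n) Y y0 (\<lambda>s\<in>topspace (unit_cube (Suc n)). H1 1 s)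
      (\<lambda>s\<in>topspace (unit_cube (Suc n)). y0)"
  proof (rule cube_homotopicI[where H = H2])
    have "continuous_map ?T (prod_topology I01 (unit_cube n))
        (\<lambda>x. (clip (min (1 - fst x) (?w (snd x))), restrict (snd x) {..<n}))"
      by (intro continuous_map_pairedI continuous_map_clip_I01 real_continuous cf cn cr)
    from continuous_map_comp2[OF f continuous_map_comp2[OF \<xi> this]]
    show "continuous_map ?T Y (\<lambda>x. H2 (fst x) (snd x))"
      by (simp add: H2_def)
    show "H2 \<sigma> s = y0" if "0 \<le> \<sigma>" "\<sigma> \<le> 1" and s: "s \<in> cube_boundary (Suc n)" for \<sigma> s
      using cube_restrict_boundary[OF s]
    proof (elim disjE)
      assume "restrict s {..<n} \<in> cube_boundary n"
      then show ?thesis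
        using at_l0[OF Nbd] by (simp add: H2_def fx0)
    qed (use that \<xi>0[OF cube_restrict_in_topspace[OF cube_boundary_subset[OF s]]]
         in \<open>simp_all add: H2_def fx0\<close>)
    show "H2 1 s = (\<lambda>s\<in>topspace (unit_cube (Suc n)). y0) s"
      if s: "s \<in> topspace (unit_cube (Suc n))" for s
    proof -
      have "min 0 (?w s) = 0"
        using cube_coord_bounds[OF s, of n] by auto
      then show ?thesis
        using \<xi>0[OF cube_restrict_in_topspace[OF s]] s by (simp add: H2_def fx0)
    qed
  qed (use H12 in auto)
  finally show ?thesis .
qed

lemma loop_class_map_inj:
  assumes n: "0 < n"
  shows "inj_on (loop_class_map n) (carrier (homotopy_group (Suc n) Y y0))"
proof -
  interpret group_hom "homotopy_group (Suc n) Y y0" "homotopy_group n L l0" "loop_class_map n"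
    by (intro group_hom.intro group_hom_axioms.intro group_homotopy_group loop_class_map_hom
        n y0 l0) simp
  show ?thesis
    unfolding inj_on_one_iff
  proof (intro allI impI)
    fix a assume "a \<in> carrier (homotopy_group (Suc n) Y y0)"
      and 1: "loop_class_map n a = \<one>\<^bsub>homotopy_group n L l0\<^esub>"
    then obtain u where u: "u \<in> cube_maps (Suc n) Y y0" and a: "a = cube_class (Suc n) Y y0 u"
      by (auto simp: carrier_homotopy_group)
    have "cube_class n L l0 (loop_adjoint n x0 u) = cube_class n L l0 (\<lambda>s\<in>topspace (unit_cube n). l0)"
      using 1 by (simp add: a loop_class_map_class[OF n u] one_homotopy_group)
    then have "cube_homotopic n L l0 (loop_adjoint n x0 u) (\<lambda>s\<in>topspace (unit_cube n). l0)"
      by (subst (asm) cube_class_eq_iff) (auto intro: loop_adjoint_in_maps n u cube_maps_const l0)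
    from cube_class_eqI[OF loop_adjoint_null[OF n u this]]
    show "a = \<one>\<^bsub>homotopy_group (Suc n) Y y0\<^esub>"
      by (simp add: a one_homotopy_group)
  qed
qed

end

section \<open>Split extensions\<close>

text \<open>The isomorphism sends \<open>(c, a)\<close> to \<open>s c \<otimes> i a\<close>; commutativity of \<open>B\<close> makes it multiplicative.\<close>

lemma split_extension_comm_iso:
  assumes ext: "split_extension A B C i p" and B: "comm_group B"
  shows "B \<cong> C \<times>\<times> A"
proof -
  interpret A: group A using ext by (simp add: split_extension_def)
  interpret B: comm_group B by (rule B)
  interpret C: group C using ext by (simp add: split_extension_def)
  have i: "i \<in> hom A B" "inj_on i (carrier A)" and p: "p \<in> hom B C"
    and ker: "i ` carrier A = kernel B C p"
    using ext by (auto simp: split_extension_def mon_def epi_def)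
  obtain s where s: "s \<in> hom C B" "\<And>c. c \<in> carrier C \<Longrightarrow> p (s c) = c"
    using ext by (auto simp: split_extension_def)
  interpret p: group_hom B C p
    by (simp add: group_hom_def group_hom_axioms_def p)
  note [simp] = hom_in_carrier[OF i(1)] hom_in_carrier[OF s(1)] hom_mult[OF i(1)] hom_mult[OF s(1)]
  have pi: "p (i a) = \<one>\<^bsub>C\<^esub>" if "a \<in> carrier A" for a
    using ker that by (auto simp: kernel_def)
  define \<phi> where "\<phi> = (\<lambda>(c, a). s c \<otimes>\<^bsub>B\<^esub> i a)"
  have "\<phi> \<in> iso (C \<times>\<times> A) B"
    unfolding iso_iff
  proof (intro conjI)
    show "\<phi> \<in> hom (C \<times>\<times> A) B"
      by (rule homI) (auto simp: \<phi>_def B.m_ac)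
    show "\<phi> ` carrier (C \<times>\<times> A) = carrier B"
    proof
      show "\<phi> ` carrier (C \<times>\<times> A) \<subseteq> carrier B"
        by (auto simp: \<phi>_def)
      show "carrier B \<subseteq> \<phi> ` carrier (C \<times>\<times> A)"
      proof
        fix b assume b: "b \<in> carrier B"
        then have "inv\<^bsub>B\<^esub> (s (p b)) \<otimes>\<^bsub>B\<^esub> b \<in> kernel B C p"
          by (simp add: kernel_def s)
        then obtain a where a: "a \<in> carrier A" "i a = inv\<^bsub>B\<^esub> (s (p b)) \<otimes>\<^bsub>B\<^esub> b"
          unfolding ker[symmetric] by auto
        have "\<phi> (p b, a) = b"
          using b by (simp add: \<phi>_def a B.m_assoc[symmetric])
        then show "b \<in> \<phi> ` carrier (C \<times>\<times> A)"
          using a b by (intro image_eqI[of _ _ "(p b, a)"]) auto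
      qed
    qed
    show "inj_on \<phi> (carrier (C \<times>\<times> A))"
    proof (rule inj_onI, clarsimp simp: \<phi>_def)
      fix c a c' a'
      assume car: "c \<in> carrier C" "a \<in> carrier A" "c' \<in> carrier C" "a' \<in> carrier A"
        and eq: "s c \<otimes>\<^bsub>B\<^esub> i a = s c' \<otimes>\<^bsub>B\<^esub> i a'"
      have "c = c'"
        using arg_cong[OF eq, of p] car by (simp add: s pi)
      then show "c = c' \<and> a = a'"
        using eq car inj_onD[OF i(2)] by auto
    qed
  qed
  then have "C \<times>\<times> A \<cong> B"
    by (auto simp: is_iso_def)
  then show ?thesis
    using group.iso_sym[OF DirProd_group[OF C.is_group A.is_group]] by blast
qed

lemma rel_Gottlieb_group_homI:
  assumes "h \<in> hom (homotopy_group n V v0) (homotopy_group m W w0)"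
    and "carrier (rel_Gottlieb_group n V v0 U u0 g) \<subseteq> carrier (homotopy_group n V v0)"
    and "h ` carrier (rel_Gottlieb_group n V v0 U u0 g) \<subseteq> carrier (rel_Gottlieb_group m W w0 U' u0' g')"
  shows "h \<in> hom (rel_Gottlieb_group n V v0 U u0 g) (rel_Gottlieb_group m W w0 U' u0' g')"
  using assms by (intro homI) (auto simp: mult_rel_Gottlieb_group intro!: hom_mult[OF assms(1)])

section \<open>The extension restricts to evaluation subgroups\<close>

context pointed_map
begin

abbreviation G_map where "G_map n \<equiv> rel_Gottlieb_group (Suc n) Y y0 X x0 f"
abbreviation G_loop where "G_loop n \<equiv> rel_Gottlieb_group n L l0 LX (const_loop x0) (canonical_loop_map f)"
abbreviation G_space where "G_space n \<equiv> rel_Gottlieb_group n X x0 X x0 id"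

text \<open>The section of the projection from \<open>L\<^sub>fY\<close> to \<open>X\<close>.  It is also the composite of the canonical
  map with the inclusion of the constant loops in the loop space of \<open>X\<close>.\<close>

definition sec :: "'a \<Rightarrow> 'a \<times> (complex \<Rightarrow> 'b)" where
  "sec x = (x, const_loop (f x))"

lemma sec_continuous: "continuous_map X L sec"
proof -
  have "continuous_map X L (\<lambda>x. (x, \<lambda>z\<in>topspace circle. f x))"
    by (rule continuous_map_into_rel_loop_space[where \<Gamma> = "\<lambda>x t. f x" and \<xi> = "\<lambda>x. x" and ?w0.0 = x0])
       (use pcX x0 fx0 in \<open>auto intro: continuous_map_comp2[OF f continuous_map_fst]\<close>)
  then show ?thesis
    by (simp add: sec_def[abs_def] const_loop_def)
qed

lemma sec_x0: "sec x0 = l0"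
  by (simp add: sec_def fx0)

lemma fst_continuous: "continuous_map L X fst"
  using continuous_map_from_rel_loop_space(1)[OF continuous_map_id[of L]] by simp

lemma compose_fst_sec:
  assumes "u \<in> cube_maps n X x0"
  shows "compose (topspace (unit_cube n)) fst (compose (topspace (unit_cube n)) sec u) = u"
  using cube_maps_extensional[OF assms] by (auto simp: compose_def sec_def fun_eq_iff extensional_def)

lemma compose_fst_loop_adjoint:
  "compose (topspace (unit_cube n)) fst (loop_adjoint n x0 u) = (\<lambda>s\<in>topspace (unit_cube n). x0)"
  by (auto simp: compose_def loop_adjoint_def)

abbreviation proj where "proj n \<equiv> homotopy_group_map n X x0 fst"
abbreviation sect where "sect n \<equiv> homotopy_group_map n L l0 sec"

lemmas proj_class = homotopy_group_map_class[OF _ fst_continuous fst_conv]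
lemmas sect_class = homotopy_group_map_class[OF _ sec_continuous sec_x0]
lemmas proj_in_maps = compose_in_cube_maps[OF _ fst_continuous fst_conv]
lemmas sect_in_maps = compose_in_cube_maps[OF _ sec_continuous sec_x0]

lemma proj_hom: "0 < n \<Longrightarrow> proj n \<in> hom (homotopy_group n L l0) (homotopy_group n X x0)"
  by (rule homotopy_group_map_hom[OF _ fst_continuous]) simp_all

lemma sect_hom: "0 < n \<Longrightarrow> sect n \<in> hom (homotopy_group n X x0) (homotopy_group n L l0)"
  by (rule homotopy_group_map_hom[OF _ sec_continuous sec_x0])

lemma proj_sect:
  "c \<in> carrier (homotopy_group n X x0) \<Longrightarrow> proj n (sect n c) = c"
  by (auto simp: carrier_homotopy_group sect_class proj_class sect_in_maps compose_fst_sec)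

lemma proj_loop_class_map:
  "0 < n \<Longrightarrow> a \<in> carrier (homotopy_group (Suc n) Y y0) \<Longrightarrow>
     proj n (loop_class_map n a) = \<one>\<^bsub>homotopy_group n X x0\<^esub>"
  by (auto simp: carrier_homotopy_group loop_class_map_class proj_class loop_adjoint_in_maps
      compose_fst_loop_adjoint one_homotopy_group)

lemma continuous_map_LX_evaluation:
  "continuous_map (prod_topology LX circle) X (\<lambda>x. fst x (snd x))"
  using continuous_map_loop_evaluation[OF continuous_map_id[of LX]] by simp

lemma continuous_map_LX_param:
  assumes "continuous_map T LX \<alpha>" "continuous_map T I01 t"
  shows "continuous_map T X (\<lambda>w. \<alpha> w (loop_param (t w)))"
proof -
  have "continuous_map T (prod_topology LX circle) (\<lambda>w. (\<alpha> w, loop_param (t w)))"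
    by (intro continuous_map_pairedI assms continuous_map_comp2[OF continuous_map_loop_param])
  from continuous_map_comp2[OF continuous_map_LX_evaluation this] show ?thesis
    by simp
qed

lemma continuous_map_LX_base:
  assumes "continuous_map T LX \<alpha>"
  shows "continuous_map T X (\<lambda>w. \<alpha> w 1)"
  using continuous_map_LX_param[OF assms, of "\<lambda>_. 0"] by simp

lemma path_connected_cube_LX: "path_connected_space (prod_topology (unit_cube n) LX)"
  by (simp add: path_connected_space_prod_topology path_connected_unit_cube path_connected_null_loop_space)

lemma base_in_cube_LX:
  "0 < n \<Longrightarrow> (\<lambda>i\<in>{..<n}. 0, const_loop x0) \<in> topspace (prod_topology (unit_cube n) LX)"
  using const_loop_in_LX cube_boundary_subset[OF origin_in_cube_boundary] by simp

text \<open>If \<open>F\<close> is \<open>f\<close> on the boundary of the \<open>(n+1)\<close>-cube, then applying \<open>F (s, t)\<close> to the point of a loop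
  \<open>\<alpha>\<close> at time \<open>t\<close> gives a loop at \<open>f (\<alpha> 1)\<close>, and this loop is \<open>f \<circ> \<alpha>\<close> for \<open>s\<close> on the boundary.\<close>

lemma loop_class_map_G_map:
  assumes n: "0 < n" and a: "a \<in> carrier (G_map n)"
  shows "loop_class_map n a \<in> carrier (G_loop n)"
proof -
  obtain F where F: "continuous_map (prod_topology (unit_cube (Suc n)) X) Y (\<lambda>x. F (fst x) (snd x))"
    and Fbd: "\<And>s x. s \<in> cube_boundary (Suc n) \<Longrightarrow> x \<in> topspace X \<Longrightarrow> F s x = f x"
    and a: "a = cube_class (Suc n) Y y0 (\<lambda>s\<in>topspace (unit_cube (Suc n)). F s x0)"
    by (rule rel_Gottlieb_classE[OF _ x0 fx0 a lcX T2X continuous_map_id x0 id_apply]) auto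
  have "continuous_map (unit_cube (Suc n)) Y (\<lambda>s. F s x0)"
    using continuous_map_comp2[OF F, of _ "\<lambda>s. (s, x0)"] x0 by (simp add: continuous_map_paired)
  then have u: "(\<lambda>s\<in>topspace (unit_cube (Suc n)). F s x0) \<in> cube_maps (Suc n) Y y0"
    by (rule cube_mapsI) (simp add: Fbd x0 fx0)
  let ?T = "prod_topology (unit_cube n) LX"
  define G where "G = (\<lambda>s \<alpha>. (\<alpha> 1, \<lambda>z\<in>topspace circle. F (s(n := loop_coord z)) (\<alpha> z)))"
  have \<alpha>X: "\<alpha> z \<in> topspace X" if "\<alpha> \<in> topspace LX" "z \<in> topspace circle" for \<alpha> z
    using continuous_map_image_subset_topspace[OF continuous_map_LX_evaluation] that by force
  have "continuous_map ?T L (\<lambda>w. (snd w 1, \<lambda>z\<in>topspace circle.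
          F ((fst w)(n := loop_coord z)) (snd w (loop_param (loop_coord z)))))"
  proof (rule continuous_map_into_rel_loop_space[OF _ _ _ _ path_connected_cube_LX base_in_cube_LX[OF n]])
    have "continuous_map (prod_topology ?T I01) (prod_topology (unit_cube (Suc n)) X)
        (\<lambda>x. ((fst (fst x))(n := snd x), snd (fst x) (loop_param (snd x))))"
      by (intro continuous_map_pairedI continuous_map_cube_extend continuous_map_snd continuous_map_LX_param
          continuous_map_comp2[OF continuous_map_fst continuous_map_fst]
          continuous_map_comp2[OF continuous_map_snd continuous_map_fst])
    from continuous_map_comp2[OF F this]
    show "continuous_map (prod_topology ?T I01) Y
        (\<lambda>x. F ((fst (fst x))(n := snd x)) (snd (fst x) (loop_param (snd x))))"
      by simp
    show "continuous_map ?T X (\<lambda>w. snd w 1)"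
      by (rule continuous_map_LX_base[OF continuous_map_snd])
    show "F ((fst (\<lambda>i\<in>{..<n}. 0, const_loop x0))(n := t)) (snd (\<lambda>i\<in>{..<n}. 0, const_loop x0) (loop_param t)) = y0"
      if "0 \<le> t" "t \<le> 1" for t
      using Fbd[OF cube_extend_boundary[OF origin_in_cube_boundary[OF n] that] x0] fx0
      by (simp add: const_loop_def)
    show "F ((fst w)(n := 0)) (snd w (loop_param 0)) = f (snd w 1)"
      "F ((fst w)(n := 1)) (snd w (loop_param 1)) = f (snd w 1)" if "w \<in> topspace ?T" for w
      using that Fbd[OF cube_extend_end_boundary \<alpha>X[of "snd w" 1], of "fst w"]
      by (simp_all add: mem_Times_iff)
  qed
  then have G: "continuous_map ?T L (\<lambda>w. G (fst w) (snd w))"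
    by (rule continuous_map_eq) (auto simp: G_def)
  have "cube_class n L l0 (\<lambda>s\<in>topspace (unit_cube n). G s (const_loop x0)) \<in> carrier (G_loop n)"
  proof (rule rel_Gottlieb_classI[OF n canonical_continuous const_loop_in_LX canonical_basepoint G])
    show "G s \<alpha> = canonical_loop_map f \<alpha>" if "s \<in> cube_boundary n" "\<alpha> \<in> topspace LX" for s \<alpha>
      using Fbd[OF cube_extend_boundary[OF that(1)]] \<alpha>X[OF that(2)] loop_coord_bounds
      by (auto simp: G_def canonical_loop_map_def compose_def fun_eq_iff)
  qed
  also have "(\<lambda>s\<in>topspace (unit_cube n). G s (const_loop x0)) =
      loop_adjoint n x0 (\<lambda>s\<in>topspace (unit_cube (Suc n)). F s x0)"
    using cube_extend_in_topspace loop_coord_bounds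
    by (auto simp: G_def loop_adjoint_def const_loop_def fun_eq_iff)
  finally show ?thesis
    by (simp add: a loop_class_map_class[OF n u])
qed

text \<open>A deformation \<open>F s\<close> of the identity of \<open>X\<close> acts on the loops of \<open>X\<close> pointwise, and then \<open>f\<close> is
  applied.\<close>

lemma sect_G_space:
  assumes n: "0 < n" and c: "c \<in> carrier (G_space n)"
  shows "sect n c \<in> carrier (G_loop n)"
proof -
  obtain F where F: "continuous_map (prod_topology (unit_cube n) X) X (\<lambda>x. F (fst x) (snd x))"
    and Fbd': "\<And>s x. s \<in> cube_boundary n \<Longrightarrow> x \<in> topspace X \<Longrightarrow> F s x = id x"
    and c: "c = cube_class n X x0 (\<lambda>s\<in>topspace (unit_cube n). F s x0)"
    by (rule rel_Gottlieb_classE[OF n x0 id_apply c lcX T2X continuous_map_id x0 id_apply]) auto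
  then have Fbd: "\<And>s x. s \<in> cube_boundary n \<Longrightarrow> x \<in> topspace X \<Longrightarrow> F s x = x"
    by simp
  have "continuous_map (unit_cube n) X (\<lambda>s. F s x0)"
    using continuous_map_comp2[OF F, of _ "\<lambda>s. (s, x0)"] x0 by (simp add: continuous_map_paired)
  then have u: "(\<lambda>s\<in>topspace (unit_cube n). F s x0) \<in> cube_maps n X x0"
    by (rule cube_mapsI) (simp add: Fbd x0)
  let ?T = "prod_topology (unit_cube n) LX"
  define G where "G = (\<lambda>s \<alpha>. (F s (\<alpha> 1), \<lambda>z\<in>topspace circle. f (F s (\<alpha> z))))"
  have \<alpha>X: "\<alpha> z \<in> topspace X" if "\<alpha> \<in> topspace LX" "z \<in> topspace circle" for \<alpha> z
    using continuous_map_image_subset_topspace[OF continuous_map_LX_evaluation] that by force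
  have "continuous_map ?T L (\<lambda>w. (F (fst w) (snd w 1), \<lambda>z\<in>topspace circle.
          f (F (fst w) (snd w (loop_param (loop_coord z))))))"
  proof (rule continuous_map_into_rel_loop_space[OF _ _ _ _ path_connected_cube_LX base_in_cube_LX[OF n]])
    have "continuous_map (prod_topology ?T I01) (prod_topology (unit_cube n) X)
        (\<lambda>x. (fst (fst x), snd (fst x) (loop_param (snd x))))"
      by (intro continuous_map_pairedI continuous_map_snd continuous_map_LX_param
          continuous_map_comp2[OF continuous_map_fst continuous_map_fst]
          continuous_map_comp2[OF continuous_map_snd continuous_map_fst])
    from continuous_map_comp2[OF f continuous_map_comp2[OF F this]]
    show "continuous_map (prod_topology ?T I01) Y (\<lambda>x. f (F (fst (fst x)) (snd (fst x) (loop_param (snd x)))))"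
      by simp
    have "continuous_map ?T (prod_topology (unit_cube n) X) (\<lambda>w. (fst w, snd w 1))"
      by (intro continuous_map_pairedI continuous_map_fst continuous_map_LX_base continuous_map_snd)
    from continuous_map_comp2[OF F this]
    show "continuous_map ?T X (\<lambda>w. F (fst w) (snd w 1))"
      by simp
    show "f (F (fst (\<lambda>i\<in>{..<n}. 0, const_loop x0)) (snd (\<lambda>i\<in>{..<n}. 0, const_loop x0) (loop_param t))) = y0"
      if "0 \<le> t" "t \<le> 1" for t
      using Fbd[OF origin_in_cube_boundary[OF n] x0] fx0 by (simp add: const_loop_def)
  qed auto
  then have G: "continuous_map ?T L (\<lambda>w. G (fst w) (snd w))"
    by (rule continuous_map_eq) (auto simp: G_def)
  have "cube_class n L l0 (\<lambda>s\<in>topspace (unit_cube n). G s (const_loop x0)) \<in> carrier (G_loop n)"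
  proof (rule rel_Gottlieb_classI[OF n canonical_continuous const_loop_in_LX canonical_basepoint G])
    show "G s \<alpha> = canonical_loop_map f \<alpha>" if "s \<in> cube_boundary n" "\<alpha> \<in> topspace LX" for s \<alpha>
      using Fbd[OF that(1)] \<alpha>X[OF that(2)]
      by (auto simp: G_def canonical_loop_map_def compose_def fun_eq_iff)
  qed
  also have "(\<lambda>s\<in>topspace (unit_cube n). G s (const_loop x0)) =
      compose (topspace (unit_cube n)) sec (\<lambda>s\<in>topspace (unit_cube n). F s x0)"
    by (auto simp: G_def sec_def compose_def const_loop_def fun_eq_iff)
  finally show ?thesis
    by (simp add: c sect_class[OF u])
qed

text \<open>Restriction to constant loops replaces the loop space by the locally compact space \<open>X\<close>, on which
  the canonical map becomes the section.\<close>

lemma G_loop_classE: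
  assumes n: "0 < n" and b: "b \<in> carrier (G_loop n)"
  obtains F where "continuous_map (prod_topology (unit_cube n) X) L (\<lambda>x. F (fst x) (snd x))"
    "\<And>s x. s \<in> cube_boundary n \<Longrightarrow> x \<in> topspace X \<Longrightarrow> F s x = sec x"
    "b = cube_class n L l0 (\<lambda>s\<in>topspace (unit_cube n). F s x0)"
    "(\<lambda>s\<in>topspace (unit_cube n). F s x0) \<in> cube_maps n L l0"
proof (rule rel_Gottlieb_classE[OF n const_loop_in_LX canonical_basepoint b lcX T2X
      continuous_map_const_loop[OF pcX x0] x0 refl])
  fix F assume F: "continuous_map (prod_topology (unit_cube n) X) L (\<lambda>x. F (fst x) (snd x))"
    and bd: "\<And>s x. s \<in> cube_boundary n \<Longrightarrow> x \<in> topspace X \<Longrightarrow> F s x = canonical_loop_map f (const_loop x)"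
    and b: "b = cube_class n L l0 (\<lambda>s\<in>topspace (unit_cube n). F s x0)"
  have bd': "F s x = sec x" if "s \<in> cube_boundary n" "x \<in> topspace X" for s x
    using bd[OF that] by (simp add: canonical_loop_map_const_loop sec_def)
  have "continuous_map (unit_cube n) L (\<lambda>s. F s x0)"
    using continuous_map_comp2[OF F, of _ "\<lambda>s. (s, x0)"] x0 by (simp add: continuous_map_paired)
  then have "(\<lambda>s\<in>topspace (unit_cube n). F s x0) \<in> cube_maps n L l0"
    by (rule cube_mapsI) (simp add: bd' x0 sec_x0)
  then show thesis
    using that[OF F bd' b] by blast
qed

lemma proj_G_loop:
  assumes n: "0 < n" and b: "b \<in> carrier (G_loop n)"
  shows "proj n b \<in> carrier (G_space n)"
proof -
  obtain F where F: "continuous_map (prod_topology (unit_cube n) X) L (\<lambda>x. F (fst x) (snd x))"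
    and Fbd: "\<And>s x. s \<in> cube_boundary n \<Longrightarrow> x \<in> topspace X \<Longrightarrow> F s x = sec x"
    and b: "b = cube_class n L l0 (\<lambda>s\<in>topspace (unit_cube n). F s x0)"
    and u: "(\<lambda>s\<in>topspace (unit_cube n). F s x0) \<in> cube_maps n L l0"
    by (rule G_loop_classE[OF n b]) blast
  have "cube_class n X x0 (\<lambda>s\<in>topspace (unit_cube n). fst (F s x0)) \<in> carrier (G_space n)"
    by (rule rel_Gottlieb_classI[OF n continuous_map_id x0 id_apply continuous_map_comp2[OF fst_continuous F]])
       (simp add: Fbd sec_def)
  also have "(\<lambda>s\<in>topspace (unit_cube n). fst (F s x0)) =
      compose (topspace (unit_cube n)) fst (\<lambda>s\<in>topspace (unit_cube n). F s x0)"
    by (auto simp: compose_def)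
  finally show ?thesis
    unfolding b proj_class[OF u] .
qed

text \<open>Write \<open>\<sigma>\<close> for the section and \<open>F = (\<xi>, \<Gamma>)\<close> for an extension of a representative of \<open>b\<close> over
  \<open>I\<^sup>n \<times> X\<close>.  In the representative of \<open>b (\<sigma> (p b))\<^sup>-\<^sup>1\<close> the cube coordinate \<open>s 0\<close> is traversed
  forth and back, at height \<open>m (s 0)\<close>, with the loops \<open>\<Gamma>\<close> on the way out and constant loops on the way
  back.  Cutting the height off at \<open>\<tau>\<close> contracts the component in \<open>X\<close> to the identity as \<open>\<tau>\<close> decreases
  to 0, and it does so for all points of \<open>X\<close> simultaneously.  The loops follow: at stage \<open>\<tau>\<close> the loop
  first climbs from the cut-off height to the true one along \<open>f \<circ> \<xi>\<close>, then runs through the original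
  loop, and finally climbs down.  This is \<open>H\<close>, with \<open>c\<close> the height and \<open>\<theta>\<close> the parameter of the original
  loop.  At \<open>\<tau> = 0\<close> the endpoints of the loops no longer depend on \<open>s\<close>, so \<open>H 0\<close> is a map on
  \<open>I\<^sup>n\<^sup>+\<^sup>1 \<times> X\<close> and provides the element of \<open>G\<^sub>n\<^sub>+\<^sub>1(Y, X; f)\<close>; at \<open>\<tau> = 1\<close> it is the product above.\<close>

lemma kernel_proj_G_loop:
  assumes n: "0 < n" and b: "b \<in> carrier (G_loop n)" and pb: "proj n b = \<one>\<^bsub>homotopy_group n X x0\<^esub>"
  shows "b \<in> loop_class_map n ` carrier (G_map n)"
proof -
  obtain F where F: "continuous_map (prod_topology (unit_cube n) X) L (\<lambda>x. F (fst x) (snd x))"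
    and Fbd: "\<And>s x. s \<in> cube_boundary n \<Longrightarrow> x \<in> topspace X \<Longrightarrow> F s x = sec x"
    and b: "b = cube_class n L l0 (\<lambda>s\<in>topspace (unit_cube n). F s x0)"
    and bm: "(\<lambda>s\<in>topspace (unit_cube n). F s x0) \<in> cube_maps n L l0"
    by (rule G_loop_classE[OF n b]) blast
  define \<Gamma> where "\<Gamma> = (\<lambda>s x t. snd (F s x) (loop_param t))"
  define \<xi> where "\<xi> = (\<lambda>s x. fst (F s x))"
  note F' = continuous_map_from_rel_loop_space[OF F]
  have \<xi>: "continuous_map (prod_topology (unit_cube n) X) X (\<lambda>x. \<xi> (fst x) (snd x))"
    using F'(1) by (simp add: \<xi>_def)
  have \<Gamma>: "continuous_map (prod_topology (prod_topology (unit_cube n) X) I01) Y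
              (\<lambda>x. \<Gamma> (fst (fst x)) (snd (fst x)) (snd x))"
    using F'(2) by (simp add: \<Gamma>_def)
  have ends: "\<Gamma> s x 0 = f (\<xi> s x)" "\<Gamma> s x 1 = f (\<xi> s x)"
    if "s \<in> topspace (unit_cube n)" "x \<in> topspace X" for s x
    using F'(3)[of "(s, x)"] that by (auto simp: \<Gamma>_def \<xi>_def)
  have bd: "\<xi> s x = x" "\<Gamma> s x t = f x" if "s \<in> cube_boundary n" "x \<in> topspace X" for s x t
    using Fbd[OF that] by (simp_all add: \<Gamma>_def \<xi>_def sec_def const_loop_def)
  define m where "m = (\<lambda>r::real. min (2 * r) (2 - 2 * r))"
  define c where "c = (\<lambda>\<tau> r t :: real. clip (min (m r) (\<tau> + min (3 * t) (3 - 3 * t))))"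
  \<comment> \<open>The original loop takes up the middle third of the time at \<open>\<tau> = 0\<close> and all of it at \<open>\<tau> = 1\<close>.  With
    the summand \<open>\<tau>\<close> in \<open>c\<close>, the bound on the height is at least 1 while \<open>\<theta>\<close> moves.\<close>
  define \<theta> where "\<theta> = (\<lambda>\<tau> t :: real. clip ((3 - 2 * \<tau>) * t - (1 - \<tau>)))"
  define H where "H = (\<lambda>\<tau> s x t. if s 0 \<le> 1/2 then \<Gamma> (s(0 := c \<tau> (s 0) t)) x (\<theta> \<tau> t)
                                  else f (\<xi> (s(0 := c \<tau> (s 0) t)) x))"
  have m: "0 \<le> m r" "m r \<le> 1" if "0 \<le> r" "r \<le> 1" for r
    using that by (auto simp: m_def)
  have c01: "0 \<le> c \<tau> r t" "c \<tau> r t \<le> 1" for \<tau> r t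
    by (simp_all add: c_def)
  have \<theta>01: "0 \<le> \<theta> \<tau> t" "\<theta> \<tau> t \<le> 1" for \<tau> t
    by (simp_all add: \<theta>_def)
  have upd: "s(0 := c \<tau> r t) \<in> topspace (unit_cube n)" if "s \<in> topspace (unit_cube n)" for s \<tau> r t
    using that n c01 by (intro cube_upd_in_topspace)
  \<comment> \<open>The turning point: the height is 1 whenever the original loop is being run through, so the cube
    point is on the boundary, where that loop is constant.\<close>
  have mid: "\<Gamma> (s(0 := c \<tau> (1/2) t)) x (\<theta> \<tau> t) = f (\<xi> (s(0 := c \<tau> (1/2) t)) x)"
    if \<tau>: "0 \<le> \<tau>" "\<tau> \<le> 1" and t: "0 \<le> t" "t \<le> 1"
      and s: "s \<in> topspace (unit_cube n)" and x: "x \<in> topspace X" for \<tau> s x t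
  proof -
    let ?l = "(3 - 2 * \<tau>) * t - (1 - \<tau>)"
    consider "?l \<le> 0" | "1 \<le> ?l" | "0 < ?l" "?l < 1"
      by linarith
    then show ?thesis
    proof cases
      case 3
      have "0 \<le> \<tau> * t" "0 \<le> \<tau> * (1 - t)"
        using \<tau> t by auto
      then have "1 \<le> \<tau> + min (3 * t) (3 - 3 * t)"
        using 3 by (auto simp: algebra_simps min_def)
      then have "c \<tau> (1/2) t = 1"
        by (simp add: c_def m_def)
      moreover have "s(0 := 1) \<in> cube_boundary n"
        using s n by (intro cube_boundary_upd) auto
      ultimately show ?thesis
        using bd x by simp
    qed (use ends[OF upd[OF s] x] in \<open>simp_all add: \<theta>_def\<close>)
  qed
  have Hbd: "H \<tau> s x t = f x" if s: "s \<in> cube_boundary n" and x: "x \<in> topspace X"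
    and t: "0 \<le> \<tau>" "0 \<le> t" "t \<le> 1" for \<tau> s x t
  proof -
    have "c \<tau> (s 0) t = 0" if "s 0 = 0 \<or> s 0 = 1"
      using that t by (auto simp: c_def m_def)
    then have "s(0 := c \<tau> (s 0) t) \<in> cube_boundary n"
      using s n c01 by (intro cube_boundary_upd_other) auto
    then show ?thesis
      using bd x by (simp add: H_def)
  qed
  have Hend: "H 0 s x t = f x" if s: "s \<in> topspace (unit_cube n)" and x: "x \<in> topspace X"
    and t: "t = 0 \<or> t = 1" for s x t
  proof -
    have "c 0 (s 0) t = 0"
      using m cube_coord_bounds[OF s n] t by (auto simp: c_def)
    moreover have "s(0 := 0) \<in> cube_boundary n"
      using s n by (intro cube_boundary_upd) auto
    ultimately show ?thesis
      using bd x by (simp add: H_def)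
  qed
  let ?U = "prod_topology (prod_topology I01 (unit_cube n)) (prod_topology X I01)"
  have H: "continuous_map ?U Y (\<lambda>w. H (fst (fst w)) (snd (fst w)) (fst (snd w)) (snd (snd w)))"
  proof -
    have cs: "continuous_map ?U (unit_cube n) (\<lambda>w. snd (fst w))"
      and cx: "continuous_map ?U X (\<lambda>w. fst (snd w))"
      and c\<tau>': "continuous_map ?U I01 (\<lambda>w. fst (fst w))"
      and ct': "continuous_map ?U I01 (\<lambda>w. snd (snd w))"
      by (intro continuous_map_comp2[OF continuous_map_fst continuous_map_fst]
          continuous_map_comp2[OF continuous_map_snd continuous_map_fst]
          continuous_map_comp2[OF continuous_map_fst continuous_map_snd]
          continuous_map_comp2[OF continuous_map_snd continuous_map_snd])+
    have c\<tau>: "continuous_map ?U euclideanreal (\<lambda>w. fst (fst w))"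
      and ct: "continuous_map ?U euclideanreal (\<lambda>w. snd (snd w))"
      using c\<tau>' ct' by (simp_all add: continuous_map_into_I01)
    have c0: "continuous_map ?U euclideanreal (\<lambda>w. snd (fst w) 0)"
      by (rule continuous_map_cube_coord[OF cs n])
    have cc: "continuous_map ?U (unit_cube n)
        (\<lambda>w. (snd (fst w))(0 := c (fst (fst w)) (snd (fst w) 0) (snd (snd w))))"
      unfolding c_def m_def by (intro continuous_map_cube_upd_clip real_continuous cs c0 c\<tau> ct n)
    have "continuous_map ?U (prod_topology (prod_topology (unit_cube n) X) I01)
        (\<lambda>w. (((snd (fst w))(0 := c (fst (fst w)) (snd (fst w) 0) (snd (snd w))), fst (snd w)),
              \<theta> (fst (fst w)) (snd (snd w))))"
      unfolding \<theta>_def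
      by (intro continuous_map_pairedI cc cx continuous_map_clip_I01 real_continuous c\<tau> ct)
    from continuous_map_comp2[OF \<Gamma> this]
    have g1: "continuous_map ?U Y (\<lambda>w. \<Gamma> ((snd (fst w))(0 := c (fst (fst w)) (snd (fst w) 0) (snd (snd w))))
        (fst (snd w)) (\<theta> (fst (fst w)) (snd (snd w))))"
      by simp
    from continuous_map_comp2[OF f continuous_map_comp2[OF \<xi> continuous_map_pairedI[OF cc cx]]]
    have g2: "continuous_map ?U Y (\<lambda>w. f (\<xi> ((snd (fst w))(0 := c (fst (fst w)) (snd (fst w) 0) (snd (snd w))))
        (fst (snd w))))"
      by simp
    show ?thesis
      unfolding H_def
    proof (rule continuous_map_cases_le[OF c0 continuous_map_real_const
          continuous_map_from_subtopology[OF g1] continuous_map_from_subtopology[OF g2]])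
      fix w assume w: "w \<in> topspace ?U" and e: "snd (fst w) 0 = 1/2"
      show "\<Gamma> ((snd (fst w))(0 := c (fst (fst w)) (snd (fst w) 0) (snd (snd w))))
          (fst (snd w)) (\<theta> (fst (fst w)) (snd (snd w))) =
        f (\<xi> ((snd (fst w))(0 := c (fst (fst w)) (snd (fst w) 0) (snd (snd w)))) (fst (snd w)))"
        unfolding e by (rule mid) (use w in auto)
    qed
  qed
  let ?T = "prod_topology (unit_cube (Suc n)) X"
  have cn: "continuous_map ?T I01 (\<lambda>w. fst w n)"
    using continuous_map_cube_coord[OF continuous_map_fst, of n "Suc n" X] cube_coord_bounds
    by (fastforce simp: continuous_map_into_I01)
  have "continuous_map ?T ?U (\<lambda>w. ((0, restrict (fst w) {..<n}), (snd w, fst w n)))"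
    by (intro continuous_map_pairedI continuous_map_cube_restrict continuous_map_fst
        continuous_map_snd cn) (simp add: continuous_map_into_I01)
  from continuous_map_comp2[OF H this]
  have G: "continuous_map ?T Y (\<lambda>w. H 0 (restrict (fst w) {..<n}) (snd w) (fst w n))"
    by simp
  have Gbd: "H 0 (restrict s {..<n}) x (s n) = f x"
    if s: "s \<in> cube_boundary (Suc n)" and x: "x \<in> topspace X" for s x
  proof -
    have s': "s \<in> topspace (unit_cube (Suc n))"
      by (rule cube_boundary_subset[OF s])
    show ?thesis
      using cube_restrict_boundary[OF s] Hbd[OF _ x, of "restrict s {..<n}" 0 "s n"]
        Hend[OF cube_restrict_in_topspace[OF s'] x] cube_coord_bounds[OF s', of n] by auto
  qed
  define a where "a = (\<lambda>s\<in>topspace (unit_cube (Suc n)). H 0 (restrict s {..<n}) x0 (s n))"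
  have aG: "cube_class (Suc n) Y y0 a \<in> carrier (G_map n)"
    unfolding a_def
    by (rule rel_Gottlieb_classI[OF zero_less_Suc f x0 fx0,
          where F = "\<lambda>s x. H 0 (restrict s {..<n}) x (s n)", OF G Gbd])
  have "continuous_map (unit_cube (Suc n)) Y (\<lambda>s. H 0 (restrict s {..<n}) x0 (s n))"
    using continuous_map_comp2[OF G, of _ "\<lambda>s. (s, x0)"] x0 by (simp add: continuous_map_paired)
  then have am: "a \<in> cube_maps (Suc n) Y y0"
    unfolding a_def by (rule cube_mapsI) (simp add: Gbd x0 fx0)
  let ?b = "\<lambda>s\<in>topspace (unit_cube n). F s x0"
  let ?p = "compose (topspace (unit_cube n)) fst ?b"
  let ?q = "compose (topspace (unit_cube n)) sec ?p"
  have pm: "?p \<in> cube_maps n X x0" and qm: "?q \<in> cube_maps n L l0"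
    using proj_in_maps[OF bm] sect_in_maps by blast+
  have hom: "cube_homotopic n L l0 (loop_adjoint n x0 a) (cube_concat n ?b (cube_reverse n ?q))"
  proof (rule cube_homotopic_in_rel_loop_space[OF n, where \<Gamma> = "\<lambda>\<tau> s t. H \<tau> s x0 t"
        and \<xi> = "\<lambda>\<tau> s. \<xi> (s(0 := clip (min (m (s 0)) \<tau>))) x0"])
    let ?T = "prod_topology I01 (unit_cube n)"
    have "continuous_map (prod_topology ?T I01) ?U (\<lambda>w. (fst w, (x0, snd w)))"
      using x0 by (intro continuous_map_pairedI continuous_map_fst continuous_map_snd) auto
    from continuous_map_comp2[OF H this]
    show "continuous_map (prod_topology ?T I01) Y (\<lambda>x. H (fst (fst x)) (snd (fst x)) x0 (snd x))"
      by simp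
    have cf: "continuous_map ?T euclideanreal fst"
      using continuous_map_fst[of I01 "unit_cube n"] by (simp add: continuous_map_into_I01)
    have c0: "continuous_map ?T euclideanreal (\<lambda>w. snd w 0)"
      by (rule continuous_map_cube_coord[OF continuous_map_snd n])
    have "continuous_map ?T (unit_cube n) (\<lambda>w. (snd w)(0 := clip (min (m (snd w 0)) (fst w))))"
      unfolding m_def by (intro continuous_map_cube_upd_clip real_continuous continuous_map_snd c0 cf n)
    then have "continuous_map ?T (prod_topology (unit_cube n) X)
        (\<lambda>w. ((snd w)(0 := clip (min (m (snd w 0)) (fst w))), x0))"
      using x0 by (intro continuous_map_pairedI) auto
    from continuous_map_comp2[OF \<xi> this]
    show "continuous_map ?T X (\<lambda>w. \<xi> ((snd w)(0 := clip (min (m (snd w 0)) (fst w)))) x0)"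
      by simp
    show "H \<tau> s x0 0 = f (\<xi> (s(0 := clip (min (m (s 0)) \<tau>))) x0)"
      "H \<tau> s x0 1 = f (\<xi> (s(0 := clip (min (m (s 0)) \<tau>))) x0)"
      if "0 \<le> \<tau>" "\<tau> \<le> 1" "s \<in> topspace (unit_cube n)" for \<tau> s
    proof -
      have e: "c \<tau> (s 0) 0 = clip (min (m (s 0)) \<tau>)" "c \<tau> (s 0) 1 = clip (min (m (s 0)) \<tau>)"
        "\<theta> \<tau> 0 = 0" "\<theta> \<tau> 1 = 1"
        using that(1,2) by (simp_all add: c_def \<theta>_def)
      show "H \<tau> s x0 0 = f (\<xi> (s(0 := clip (min (m (s 0)) \<tau>))) x0)"
        "H \<tau> s x0 1 = f (\<xi> (s(0 := clip (min (m (s 0)) \<tau>))) x0)"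
        using ends[OF upd[OF that(3)] x0, of \<tau> "s 0" 0] by (simp_all add: H_def e)
    qed
    show "\<xi> (s(0 := clip (min (m (s 0)) \<tau>))) x0 = x0"
      if "0 \<le> \<tau>" "\<tau> \<le> 1" "s \<in> cube_boundary n" for \<tau> s
    proof (rule bd(1)[OF _ x0], rule cube_boundary_upd_other[OF that(3) n])
      show "clip (min (m (s 0)) \<tau>) = 0 \<or> clip (min (m (s 0)) \<tau>) = 1" if "s 0 = 0 \<or> s 0 = 1"
        using that \<open>0 \<le> \<tau>\<close> by (auto simp: m_def)
    qed auto
    show "H \<tau> s x0 t = y0" if "0 \<le> \<tau>" "\<tau> \<le> 1" "s \<in> cube_boundary n" "0 \<le> t" "t \<le> 1" for \<tau> s t
      using Hbd[OF that(3) x0 that(1,4,5)] by (simp add: fx0)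
    show "loop_adjoint n x0 a \<in> extensional (topspace (unit_cube n))"
      by (simp add: loop_adjoint_def)
    show "cube_concat n ?b (cube_reverse n ?q) \<in> extensional (topspace (unit_cube n))"
      by (simp add: cube_concat_def)
    show "loop_adjoint n x0 a s =
        (\<xi> (s(0 := clip (min (m (s 0)) 0))) x0, \<lambda>z\<in>topspace circle. H 0 s x0 (loop_coord z))"
      if s: "s \<in> topspace (unit_cube n)" for s
    proof -
      have "min (m (s 0)) 0 = 0"
        using m cube_coord_bounds[OF s n] by auto
      moreover have "s(0 := 0) \<in> cube_boundary n"
        using s n by (intro cube_boundary_upd) auto
      ultimately have "\<xi> (s(0 := clip (min (m (s 0)) 0))) x0 = x0"
        using bd x0 by simp
      then show ?thesis
        using s cube_extend_in_topspace[OF s] loop_coord_bounds cube_extend_restrict[OF s, of "s n"]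
        by (simp add: loop_adjoint_def a_def cong: restrict_cong)
    qed
    show "cube_concat n ?b (cube_reverse n ?q) s =
        (\<xi> (s(0 := clip (min (m (s 0)) 1))) x0, \<lambda>z\<in>topspace circle. H 1 s x0 (loop_coord z))"
      if s: "s \<in> topspace (unit_cube n)" for s
    proof -
      have s0: "0 \<le> s 0" "s 0 \<le> 1"
        using cube_coord_bounds[OF s n] by auto
      have m1: "clip (min (m (s 0)) 1) = m (s 0)" 
        using m[OF s0] by simp
      have c1: "c 1 (s 0) t = m (s 0)" "\<theta> 1 t = t" if "0 \<le> t" "t \<le> 1" for t
      proof -
        have "min (m (s 0)) (1 + min (3 * t) (3 - 3 * t)) = m (s 0)"
          using m[OF s0] that by auto
        then show "c 1 (s 0) t = m (s 0)"
          using m[OF s0] by (simp add: c_def)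
        show "\<theta> 1 t = t"
          using that by (simp add: \<theta>_def)
      qed
      have up: "s(0 := r) \<in> topspace (unit_cube n)" if "0 \<le> r" "r \<le> 1" for r
        using s n that by (intro cube_upd_in_topspace)
      show ?thesis
      proof (cases "s 0 \<le> 1/2")
        case True
        then have ms: "m (s 0) = 2 * s 0"
          by (simp add: m_def)
        have u: "s(0 := 2 * s 0) \<in> topspace (unit_cube n)"
          using True s0 by (intro up) auto
        have "F (s(0 := 2 * s 0)) x0 \<in> topspace L"
          using continuous_map_image_subset_topspace[OF F] u x0 by force
        then have "snd (F (s(0 := 2 * s 0)) x0) \<in> extensional (topspace circle)"
          using rel_loop_space_loop_extensional by (metis prod.collapse)
        then have "(\<lambda>z\<in>topspace circle. H 1 s x0 (loop_coord z)) = snd (F (s(0 := 2 * s 0)) x0)"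
          using True c1 ms loop_coord_bounds by (auto simp: H_def \<Gamma>_def fun_eq_iff extensional_def)
        then show ?thesis
          using True s u m1 ms by (simp add: cube_concat_def \<xi>_def)
      next
        case False
        then have ms: "m (s 0) = 2 - 2 * s 0"
          by (simp add: m_def)
        have u: "s(0 := 2 * s 0 - 1) \<in> topspace (unit_cube n)" "s(0 := 2 - 2 * s 0) \<in> topspace (unit_cube n)"
          using False s0 by (auto intro!: up)
        have "(\<lambda>z\<in>topspace circle. H 1 s x0 (loop_coord z)) = const_loop (f (\<xi> (s(0 := 2 - 2 * s 0)) x0))"
          using False c1 ms loop_coord_bounds by (auto simp: H_def const_loop_def fun_eq_iff)
        then show ?thesis
          using False s u m1 ms
          by (simp add: cube_concat_def cube_reverse_def compose_def sec_def \<xi>_def)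
      qed
    qed
  qed
  interpret \<pi>: group "homotopy_group n L l0"
    by (rule group_homotopy_group[OF n l0])
  interpret \<sigma>: group_hom "homotopy_group n X x0" "homotopy_group n L l0" "sect n"
    by (intro group_hom.intro group_hom_axioms.intro group_homotopy_group n x0 l0 sect_hom)
  have "b \<in> carrier (homotopy_group n L l0)"
    using bm by (simp add: b carrier_homotopy_group)
  then have "b \<otimes>\<^bsub>homotopy_group n L l0\<^esub> inv\<^bsub>homotopy_group n L l0\<^esub> (sect n (proj n b)) = b"
    by (simp add: pb)
  moreover have "loop_class_map n (cube_class (Suc n) Y y0 a) =
      b \<otimes>\<^bsub>homotopy_group n L l0\<^esub> inv\<^bsub>homotopy_group n L l0\<^esub> (sect n (proj n b))"
    using cube_class_eqI[OF hom]
    by (simp add: loop_class_map_class[OF n am] b proj_class[OF bm] sect_class[OF pm]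
        inv_homotopy_group[OF n l0 qm] mult_homotopy_group[OF n bm cube_reverse_in_maps[OF n qm]])
  ultimately show ?thesis
    using aG by (metis image_eqI)
qed

lemma G_map_subset: "carrier (G_map n) \<subseteq> carrier (homotopy_group (Suc n) Y y0)"
  by (rule subgroup.subset[OF subgroup_rel_Gottlieb_group[OF _ f x0 fx0]]) simp

lemma G_loop_subset: "0 < n \<Longrightarrow> carrier (G_loop n) \<subseteq> carrier (homotopy_group n L l0)"
  by (rule subgroup.subset, rule subgroup_rel_Gottlieb_group)
     (auto intro: canonical_continuous const_loop_in_LX canonical_basepoint)

lemma G_space_subset: "0 < n \<Longrightarrow> carrier (G_space n) \<subseteq> carrier (homotopy_group n X x0)"
  by (rule subgroup.subset[OF subgroup_rel_Gottlieb_group[OF _ continuous_map_id x0 id_apply]])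

lemma split_extension_evaluation:
  assumes n: "0 < n"
  shows "split_extension (G_map n) (G_loop n) (G_space n) (loop_class_map n) (proj n)"
  unfolding split_extension_def
proof (intro conjI)
  show "group (G_map n)" "group (G_loop n)" "group (G_space n)"
    by (intro group_rel_Gottlieb_group n f x0 fx0 canonical_continuous const_loop_in_LX
        canonical_basepoint continuous_map_id id_apply zero_less_Suc)+
  have p: "proj n \<in> hom (G_loop n) (G_space n)" and s: "sect n \<in> hom (G_space n) (G_loop n)"
    and i: "loop_class_map n \<in> hom (G_map n) (G_loop n)"
    using proj_G_loop[OF n] sect_G_space[OF n] loop_class_map_G_map[OF n]
    by (auto intro!: rel_Gottlieb_group_homI proj_hom sect_hom loop_class_map_hom n G_map_subset
        G_loop_subset G_space_subset)
  show "loop_class_map n \<in> mon (G_map n) (G_loop n)"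
    using i inj_on_subset[OF loop_class_map_inj[OF n] G_map_subset] by (simp add: mon_def)
  have ps: "proj n (sect n c) = c" if "c \<in> carrier (G_space n)" for c
    using proj_sect G_space_subset[OF n] that by blast
  then show "\<exists>s\<in>hom (G_space n) (G_loop n). \<forall>c\<in>carrier (G_space n). proj n (s c) = c"
    using s by blast
  have "carrier (G_space n) \<subseteq> proj n ` carrier (G_loop n)"
    using ps sect_G_space[OF n] by (metis image_eqI subsetI)
  then show "proj n \<in> epi (G_loop n) (G_space n)"
    using p proj_G_loop[OF n] by (auto simp: epi_def)
  show "loop_class_map n ` carrier (G_map n) = kernel (G_loop n) (G_space n) (proj n)"
  proof (intro equalityI subsetI)
    fix b assume "b \<in> loop_class_map n ` carrier (G_map n)"
    then obtain a where a: "a \<in> carrier (G_map n)" "b = loop_class_map n a"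
      by blast
    then show "b \<in> kernel (G_loop n) (G_space n) (proj n)"
      using loop_class_map_G_map[OF n a(1)] proj_loop_class_map[OF n subsetD[OF G_map_subset a(1)]]
      by (simp add: kernel_def one_rel_Gottlieb_group)
  next
    fix b assume "b \<in> kernel (G_loop n) (G_space n) (proj n)"
    then show "b \<in> loop_class_map n ` carrier (G_map n)"
      by (intro kernel_proj_G_loop[OF n]) (simp_all add: kernel_def one_rel_Gottlieb_group)
  qed
qed

lemma comm_groups_evaluation:
  assumes n: "2 \<le> n"
  shows "comm_group (G_map n)" "comm_group (G_loop n)" "comm_group (G_space n)"
  by (intro comm_group_rel_Gottlieb_group f x0 fx0 canonical_continuous const_loop_in_LX
      canonical_basepoint continuous_map_id id_apply; use n in simp)+

end

theorem theorem4p1: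
  fixes X :: "'a topology" and x0 :: 'a
    and Y :: "'b topology" and y0 :: 'b
    and f :: "'a \<Rightarrow> 'b"
  assumes X: "path_connected_space X" "locally_compact_space X" "Hausdorff_space X"
      "well_pointed X x0"
    and Y: "path_connected_space Y" "locally_compact_space Y" "Hausdorff_space Y"
      "well_pointed Y y0"
    and f: "continuous_map X Y f" "f x0 = y0"
  shows "\<forall>n\<ge>1.
    let A = rel_Gottlieb_group (n + 1) Y y0 X x0 f;
        B = rel_Gottlieb_group n
              (rel_loop_space X Y y0 f) (x0, const_loop y0)
              (null_loop_space X x0) (const_loop x0)
              (canonical_loop_map f);
        C = Gottlieb_group n X x0
    in (\<exists>i p. split_extension A B C i p) \<and>
       (n \<ge> 2 \<longrightarrow> comm_group A \<and> comm_group B \<and> comm_group C \<and> B \<cong> C \<times>\<times> A)"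
proof -
  interpret pointed_map X x0 Y y0 f
    using X f by unfold_locales (auto simp: well_pointed_def)
  show ?thesis
  proof (intro allI impI)
    fix n :: nat assume "1 \<le> n"
    then have ext: "split_extension (G_map n) (G_loop n) (G_space n) (loop_class_map n) (proj n)"
      by (intro split_extension_evaluation) simp
    have "comm_group (G_map n) \<and> comm_group (G_loop n) \<and> comm_group (G_space n) \<and> G_loop n \<cong> G_space n \<times>\<times> G_map n"
      if "2 \<le> n"
      using comm_groups_evaluation[OF that] split_extension_comm_iso[OF ext] by blast
    with ext show "let A = rel_Gottlieb_group (n + 1) Y y0 X x0 f;
        B = rel_Gottlieb_group n (rel_loop_space X Y y0 f) (x0, const_loop y0)
              (null_loop_space X x0) (const_loop x0) (canonical_loop_map f);
        C = Gottlieb_group n X x0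
      in (\<exists>i p. split_extension A B C i p) \<and>
         (n \<ge> 2 \<longrightarrow> comm_group A \<and> comm_group B \<and> comm_group C \<and> B \<cong> C \<times>\<times> A)"
      by (auto simp: Let_def Gottlieb_group_def)
  qed
qed

end
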